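(* Let $\nu,d\ge2$. Then there exists a $\mathbb Z^d$-periodic graph $\Gamma$, with a fundamental graph having $\nu$ vertices, such that the spectrum of the Laplacian $\Delta$ on $\Gamma$ has exactly $2$ non-degenerate separated (disjoint) spectral bands $\sigma_1(\Delta)$ and $\sigma_\nu(\Delta)$ and, between them, in the gap, $\nu-2$ degenerate spectral bands (flat bands) $\sigma_2(\Delta)=\ldots=\sigma_{\nu-1}(\Delta)$.
   Context: A $\mathbb Z^d$-periodic graph $\Gamma=(V,\mathcal E)$ ($d\ge2$) is a connected graph embedded in $\mathbb R^d$, possibly with loops and multiple edges, with vertex set $V$ and set $\mathcal E$ of unoriented edges, such that: any bounded domain of $\mathbb R^d$ contains finitely many vertices; every vertex has finite degree (number of incident edges, a loop counted twice); and there is a basis $a_1,\ldots,a_d$ of $\mathbb R^d$ (the periods) with $\Gamma+a_s=\Gamma$ for $s=1,\ldots,d$. Coordinates are taken with some origin and axes along $a_1,\ldots,a_d$, so that $\Gamma+m=\Gamma$ for all $m\in\mathbb Z^d$. Each unoriented edge gives two oriented edges $(u,v)$ and $(v,u)$ (an unoriented loop gives two oriented loops); $\mathcal A$ is the set of oriented edges. The fundamental graph is $\Gamma_f=\Gamma/\mathbb Z^d$; it is finite, its vertices are identified with $V\cap[0,1)^d=\{v_1,\ldots,v_\nu\}$, and $\mathcal A_f=\mathcal A/\mathbb Z^d$ is its set of oriented edges. Every $v\in V$ is uniquely $v=[v]+\tilde v$ with $[v]\in\mathbb Z^d$, $\tilde v\in V\cap[0,1)^d$. The index of $\mathbf e=(u,v)\in\mathcal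 A$ is $\tau(\mathbf e)=[v]-[u]\in\mathbb Z^d$; it is $\mathbb Z^d$-translation invariant and defines the index of the corresponding edge of $\mathcal A_f$. $(\Delta f)(v)=\sum_{(v,u)_e\in\mathcal E}(f(v)-f(u))$ on $\ell^2(V)$. Its Floquet matrices, for $\vartheta\in\mathbb T^d=\mathbb R^d/(2\pi\mathbb Z)^d$, are $\Delta_{jk}(\vartheta)=\varkappa_j\delta_{jk}-\sum_{\mathbf e=(v_j,v_k)\in\mathcal A_f}e^{i\langle\tau(\mathbf e),\vartheta\rangle}$, $\varkappa_j=\deg v_j$. The eigenvalues of $\Delta(\vartheta)$ are $\lambda_1^0(\vartheta)\le\ldots\le\lambda_\nu^0(\vartheta)$ (with multiplicity), the spectral bands are $\sigma_n(\Delta)=\lambda_n^0(\mathbb T^d)$, and $\sigma(\Delta)=\bigcup_n\sigma_n(\Delta)$. A band is degenerate (a flat band) if it is a single point; it is then an eigenvalue of $\Delta$ of infinite multiplicity. *)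

theory Defs
  imports "HOL-Analysis.Analysis" "Jordan_Normal_Form.Char_Poly"
begin

text \<open>
  A graph embedded in R^d, together with its periods. An edge is the point set of its curve, so
  multiple edges are different curves with the same end points, and lattice vectors act on vertices
  and edges simply by translation of points and of sets.
\<close>

record 'd pgraph =
  verts :: "(real^'d) set"
  edges :: "(real^'d) set set"
  period :: "'d \<Rightarrow> real^'d"

text \<open>
  A simple path may be closed, which gives the loops. The condition on \<open>e \<inter> V\<close> says both that the
  end points of an edge are vertices and that no vertex lies in its interior; hence the ends of an
  edge \<open>e\<close> can be recovered as \<open>e \<inter> V\<close>.
\<close>

definition embedded_in_space :: "'d::finite pgraph \<Rightarrow> bool" where
  "embedded_in_space G \<longleftrightarrow>
     (\<forall>e\<in>edges G. \<exists>g. simple_path g \<and> path_image g = e \<and> e \<inter> verts G = {pathstart g, pathfinish g}) \<and>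
     (\<forall>e\<in>edges G. \<forall>e'\<in>edges G. e \<noteq> e' \<longrightarrow> e \<inter> e' \<subseteq> verts G)"

definition connected_pgraph :: "'d::finite pgraph \<Rightarrow> bool" where
  "connected_pgraph G \<longleftrightarrow> verts G \<noteq> {} \<and>
     (\<forall>u\<in>verts G. \<forall>v\<in>verts G. (u, v) \<in> {(x, y). \<exists>e\<in>edges G. e \<inter> verts G = {x, y}}\<^sup>*)"

definition periodic_graph :: "'d::finite pgraph \<Rightarrow> bool" where
  "periodic_graph G \<longleftrightarrow>
     embedded_in_space G \<and> connected_pgraph G \<and>
     (\<forall>B. bounded B \<longrightarrow> finite (verts G \<inter> B)) \<and>
     (\<forall>v\<in>verts G. finite {e \<in> edges G. v \<in> e}) \<and>
     inj (period G) \<and> independent (range (period G)) \<and> span (range (period G)) = UNIV \<and>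
     (\<forall>s. (+) (period G s) ` verts G = verts G \<and>
          (\<lambda>e. (+) (period G s) ` e) ` edges G = edges G)"

text \<open>
  An oriented edge is \<open>(e, u, v, b)\<close> with \<open>e\<close> running from \<open>u\<close> to \<open>v\<close>. The tag \<open>b\<close> can be set
  only on loops and distinguishes their two orientations.
\<close>

type_synonym 'd oedge = "(real^'d) set \<times> (real^'d) \<times> (real^'d) \<times> bool"

definition oriented_edges :: "'d::finite pgraph \<Rightarrow> 'd oedge set" where
  "oriented_edges G = {(e, u, v, b). e \<in> edges G \<and> e \<inter> verts G = {u, v} \<and> (b \<longrightarrow> u = v)}"

definition init :: "'d oedge \<Rightarrow> real^'d" where
  "init a = fst (snd a)"

definition ter :: "'d oedge \<Rightarrow> real^'d" where
  "ter a = fst (snd (snd a))"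

definition degree_at :: "'d::finite pgraph \<Rightarrow> real^'d \<Rightarrow> nat" where
  "degree_at G v = card {a \<in> oriented_edges G. init a = v}"

definition lattice_vector :: "'d::finite pgraph \<Rightarrow> int^'d \<Rightarrow> real^'d" where
  "lattice_vector G m = (\<Sum>s\<in>UNIV. of_int (vec_nth m s) *\<^sub>R period G s)"

definition unit_cell :: "'d::finite pgraph \<Rightarrow> (real^'d) set" where
  "unit_cell G = {(\<Sum>s\<in>UNIV. t s *\<^sub>R period G s) | t. \<forall>s. 0 \<le> t s \<and> t s < 1}"

definition int_part :: "'d::finite pgraph \<Rightarrow> real^'d \<Rightarrow> int^'d" where
  "int_part G v = (THE m. v - lattice_vector G m \<in> unit_cell G)"

definition cell_part :: "'d::finite pgraph \<Rightarrow> real^'d \<Rightarrow> real^'d" where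
  "cell_part G v = v - lattice_vector G (int_part G v)"

definition fund_verts :: "'d::finite pgraph \<Rightarrow> (real^'d) set" where
  "fund_verts G = verts G \<inter> unit_cell G"

definition edge_index :: "'d::finite pgraph \<Rightarrow> 'd oedge \<Rightarrow> int^'d" where
  "edge_index G a = int_part G (ter a) - int_part G (init a)"

definition shift_oedge :: "real^'d \<Rightarrow> 'd oedge \<Rightarrow> 'd::finite oedge" where
  "shift_oedge x = (\<lambda>(e, u, v, b). ((+) x ` e, x + u, x + v, b))"

definition fund_oriented_edges :: "'d::finite pgraph \<Rightarrow> 'd oedge set set" where
  "fund_oriented_edges G = oriented_edges G //
     {(a, a'). a \<in> oriented_edges G \<and> a' \<in> oriented_edges G \<and>
               (\<exists>m. a' = shift_oedge (lattice_vector G m) a)}"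

text \<open>
  For a class \<open>c\<close> of oriented edges, the start and end points modulo the lattice and the index do
  not depend on the representative.
\<close>

definition fund_init :: "'d::finite pgraph \<Rightarrow> 'd oedge set \<Rightarrow> real^'d" where
  "fund_init G c = the_elem ((\<lambda>a. cell_part G (init a)) ` c)"

definition fund_ter :: "'d::finite pgraph \<Rightarrow> 'd oedge set \<Rightarrow> real^'d" where
  "fund_ter G c = the_elem ((\<lambda>a. cell_part G (ter a)) ` c)"

definition fund_index :: "'d::finite pgraph \<Rightarrow> 'd oedge set \<Rightarrow> int^'d" where
  "fund_index G c = the_elem (edge_index G ` c)"

text \<open>
  The Laplacian on square-summable functions on the vertices, extended by 0 outside the vertex set.
  The sum over unoriented edges at \<open>v\<close> is a sum over the oriented edges starting at \<open>v\<close>; loops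
  contribute 0. For a bounded operator the resolvent set consists of the points where
  \<open>\<Delta> - \<lambda>\<close> is a bijection with bounded inverse.
\<close>

definition laplacian :: "'d::finite pgraph \<Rightarrow> (real^'d \<Rightarrow> complex) \<Rightarrow> real^'d \<Rightarrow> complex" where
  "laplacian G f v =
     (if v \<in> verts G then \<Sum>a | a \<in> oriented_edges G \<and> init a = v. f v - f (ter a) else 0)"

definition l2 :: "'d::finite pgraph \<Rightarrow> (real^'d \<Rightarrow> complex) set" where
  "l2 G = {f. (\<forall>v. v \<notin> verts G \<longrightarrow> f v = 0) \<and> (\<lambda>v. (cmod (f v))\<^sup>2) summable_on verts G}"

definition l2_norm :: "'d::finite pgraph \<Rightarrow> (real^'d \<Rightarrow> complex) \<Rightarrow> real" where
  "l2_norm G f = sqrt (\<Sum>\<^sub>\<infinity>v\<in>verts G. (cmod (f v))\<^sup>2)"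

definition laplacian_spectrum :: "'d::finite pgraph \<Rightarrow> complex set" where
  "laplacian_spectrum G = {z.
     \<not> (bij_betw (\<lambda>f v. laplacian G f v - z * f v) (l2 G) (l2 G) \<and>
        (\<exists>C. \<forall>f\<in>l2 G. l2_norm G f \<le> C * l2_norm G (\<lambda>v. laplacian G f v - z * f v)))}"

text \<open>
  The Floquet matrices need some enumeration of the fundamental vertices; another choice conjugates
  all of them by one permutation matrix. The quasimomentum is a vector in R^d; the
  matrices are periodic in each coordinate with period 2 pi, so the range over R^d used for the
  bands is the range over the torus.
\<close>

definition fund_vertex :: "'d::finite pgraph \<Rightarrow> nat \<Rightarrow> real^'d" where
  "fund_vertex G = (SOME h. bij_betw h {..<card (fund_verts G)} (fund_verts G))"

definition floquet_matrix :: "'d::finite pgraph \<Rightarrow> real^'d \<Rightarrow> complex mat" where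
  "floquet_matrix G \<theta> = mat (card (fund_verts G)) (card (fund_verts G)) (\<lambda>(j, k).
     (if j = k then of_nat (degree_at G (fund_vertex G j)) else 0) -
     (\<Sum>c | c \<in> fund_oriented_edges G \<and>
            fund_init G c = fund_vertex G j \<and> fund_ter G c = fund_vertex G k.
        exp (\<i> * of_real (\<Sum>s\<in>UNIV. of_int (vec_nth (fund_index G c) s) * vec_nth \<theta> s))))"

text \<open>The eigenvalues of a Hermitian matrix in increasing order, with multiplicity.\<close>

definition sorted_eigenvalues :: "complex mat \<Rightarrow> real list" where
  "sorted_eigenvalues A =
     (THE xs. sorted xs \<and> char_poly A = (\<Prod>x\<leftarrow>xs. [:- complex_of_real x, 1:]))"

text \<open>Bands are numbered from 1.\<close>

definition band :: "'d::finite pgraph \<Rightarrow> nat \<Rightarrow> real set" where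
  "band G n = range (\<lambda>\<theta>. sorted_eigenvalues (floquet_matrix G \<theta>) ! (n - 1))"

end

theory Submission
  imports Defs
begin

text \<open>
  Take the lattice \<open>Z^d\<close> and attach \<open>\<nu> - 1\<close> pendant vertices to every lattice point. Functions that
  live on the pendant vertices of one lattice point and sum to zero there are eigenfunctions for the
  eigenvalue 1, which gives the \<open>\<nu> - 2\<close> flat bands. The other two Floquet eigenvalues are the roots of
  \<open>x\<^sup>2 - (E + \<nu>) x + E\<close>, where \<open>E = 2 d - 2 (cos \<theta>\<^sub>1 + \<dots> + cos \<theta>\<^sub>d)\<close> runs over \<open>[0, 4 d]\<close>; they lie on
  different sides of 1, and \<open>E\<close> can be recovered from either of them. On the other side, eliminating
  the pendant vertices from \<open>(\<Delta> - z) f = h\<close> reduces the spectrum of \<open>\<Delta>\<close> to that of the adjacency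
  operator of \<open>Z^d\<close>, which is \<open>[- 2 d, 2 d]\<close>: outside, the resolvent is a Neumann series, and inside there
  are approximate eigenfunctions.
\<close>

section \<open>The adjacency operator of the lattice\<close>

text \<open>The spectrum is defined through the operator and not through the bands, so their
  agreement has to be proved; this is done without a Floquet-Bloch decomposition. Both sides lead to
  the same quadratic: \<open>schur z = 2 d - E\<close> turns into
  \<open>z^2 - (E + \<nu>) z + E = 0\<close> after multiplication by \<open>1 - z\<close>, and E to
  2 d - E carries the energies [0, 4 d] onto [-2 d, 2 d]. The obstacle is z = 1, the pole of
  \<open>schur\<close>, where the elimination breaks down and the answer depends on
  \<open>\<nu>\<close>. With at least two pendant vertices per lattice point, 1 is an eigenvalue;
  with a single one, Delta - 1 has an explicit bounded inverse, in accordance with the absence of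
  middle bands. The gap comes from the value 1 - \<nu> < 0 of the quadratic at 1, which is the same
  for all E. No spectral theorem is invoked: the symmetry of the adjacency operator enters through
  one vanishing sum, which excludes non-real spectrum.\<close>

definition sq_summable :: "('i \<Rightarrow> complex) \<Rightarrow> bool" where
  "sq_summable f \<longleftrightarrow> (\<lambda>x. (cmod (f x))\<^sup>2) summable_on UNIV"

definition sq_norm :: "('i \<Rightarrow> complex) \<Rightarrow> real" where
  "sq_norm f = sqrt (\<Sum>\<^sub>\<infinity>x. (cmod (f x))\<^sup>2)"

lemma sq_norm_nonneg [simp]: "0 \<le> sq_norm f"
  unfolding sq_norm_def by (intro real_sqrt_ge_zero infsum_nonneg) auto

lemma sq_norm_power2: "(sq_norm f)\<^sup>2 = (\<Sum>\<^sub>\<infinity>x. (cmod (f x))\<^sup>2)"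
  unfolding sq_norm_def by (intro real_sqrt_pow2 infsum_nonneg) auto

lemma L2_set_le_sq_norm:
  assumes "sq_summable f" "finite F"
  shows "L2_set (\<lambda>x. cmod (f x)) F \<le> sq_norm f"
  unfolding L2_set_def sq_norm_def
  using assms by (intro real_sqrt_le_mono finite_sum_le_infsum) (auto simp: sq_summable_def)

text \<open>A uniform bound over finite sets gives summability and the norm bound together, so
  estimates for infinite families reduce to the finite Minkowski inequality for
  \<open>L2_set\<close>.\<close>

lemma sq_summableI_bounded:
  assumes "\<And>F. finite F \<Longrightarrow> L2_set (\<lambda>x. cmod (f x)) F \<le> C"
  shows "sq_summable f" "sq_norm f \<le> C"
proof -
  have C: "0 \<le> C" using assms[of "{}"] by simp
  have *: "(\<Sum>x\<in>F. (cmod (f x))\<^sup>2) \<le> C\<^sup>2" if "finite F" for F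
    using assms[OF that] C unfolding L2_set_def
    by (metis L2_set_def L2_set_nonneg abs_of_nonneg power_mono real_sqrt_abs real_sqrt_le_iff)
  have "bdd_above (sum (\<lambda>x. (cmod (f x))\<^sup>2) ` {F. F \<subseteq> UNIV \<and> finite F})"
    using * by (auto intro!: bdd_aboveI2)
  then show s: "sq_summable f"
    unfolding sq_summable_def by (intro nonneg_bdd_above_summable_on) auto
  have "(\<Sum>\<^sub>\<infinity>x. (cmod (f x))\<^sup>2) \<le> C\<^sup>2"
    using s unfolding sq_summable_def by (intro infsum_le_finite_sums) (auto intro: *)
  then show "sq_norm f \<le> C"
    unfolding sq_norm_def using C by (metis real_sqrt_le_mono real_sqrt_abs abs_of_nonneg)
qed

lemma cmod_le_sq_norm: "sq_summable f \<Longrightarrow> cmod (f x) \<le> sq_norm f"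
  using L2_set_le_sq_norm[of f "{x}"] by simp

lemma sq_summable_add:
  assumes "sq_summable f" "sq_summable g"
  shows "sq_summable (\<lambda>x. f x + g x)" "sq_norm (\<lambda>x. f x + g x) \<le> sq_norm f + sq_norm g"
proof -
  have "L2_set (\<lambda>x. cmod (f x + g x)) F \<le> sq_norm f + sq_norm g" if "finite F" for F
  proof -
    have "L2_set (\<lambda>x. cmod (f x + g x)) F \<le> L2_set (\<lambda>x. cmod (f x) + cmod (g x)) F"
      by (intro L2_set_mono) (auto simp: norm_triangle_ineq)
    also have "\<dots> \<le> L2_set (\<lambda>x. cmod (f x)) F + L2_set (\<lambda>x. cmod (g x)) F"
      by (rule L2_set_triangle_ineq)
    finally show ?thesis
      using L2_set_le_sq_norm[OF assms(1) that] L2_set_le_sq_norm[OF assms(2) that] by linarith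
  qed
  from sq_summableI_bounded[OF this]
  show "sq_summable (\<lambda>x. f x + g x)" "sq_norm (\<lambda>x. f x + g x) \<le> sq_norm f + sq_norm g"
    by simp_all
qed

lemma sq_norm_cmult: "sq_norm (\<lambda>x. c * f x) = cmod c * sq_norm f"
  by (simp add: sq_norm_def norm_mult power_mult_distrib infsum_cmult_right' real_sqrt_mult)

lemma sq_summable_cmult: "sq_summable f \<Longrightarrow> sq_summable (\<lambda>x. c * f x)"
  unfolding sq_summable_def norm_mult power_mult_distrib by (intro summable_on_cmult_right)

lemma sq_summable_0: "sq_summable (\<lambda>x. 0)"
  by (simp add: sq_summable_def)

lemma sq_norm_0 [simp]: "sq_norm (\<lambda>x. 0) = 0"
  by (simp add: sq_norm_def)

lemma sq_summable_uminus: "sq_summable f \<Longrightarrow> sq_summable (\<lambda>x. - f x)"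
  by (simp add: sq_summable_def)

lemma sq_norm_uminus: "sq_norm (\<lambda>x. - f x) = sq_norm f"
  by (simp add: sq_norm_def)

lemma sq_summable_diff:
  assumes "sq_summable f" "sq_summable g"
  shows "sq_summable (\<lambda>x. f x - g x)" "sq_norm (\<lambda>x. f x - g x) \<le> sq_norm f + sq_norm g"
  using sq_summable_add[OF assms(1) sq_summable_uminus[OF assms(2)]] by (simp_all add: sq_norm_uminus)

lemma sq_summable_sum:
  assumes "\<And>i. i \<in> I \<Longrightarrow> sq_summable (f i)"
  shows "sq_summable (\<lambda>x. \<Sum>i\<in>I. f i x)"
        "sq_norm (\<lambda>x. \<Sum>i\<in>I. f i x) \<le> (\<Sum>i\<in>I. sq_norm (f i))"
  using assms
proof (induction I rule: infinite_finite_induct)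
  case (insert i I)
  { case 1 then show ?case using insert sq_summable_add(1)[of "f i"] by simp }
  { case 2
    then show ?case
      using insert sq_summable_add(2)[of "f i" "\<lambda>x. \<Sum>i\<in>I. f i x"] by force }
qed (auto simp: sq_summable_0)

lemma sq_summable_reindex:
  assumes "bij \<sigma>"
  shows "sq_summable (\<lambda>x. f (\<sigma> x)) \<longleftrightarrow> sq_summable f" "sq_norm (\<lambda>x. f (\<sigma> x)) = sq_norm f"
  unfolding sq_summable_def sq_norm_def
  using summable_on_reindex_bij_betw[OF assms, of "\<lambda>x. (cmod (f x))\<^sup>2"]
    infsum_reindex_bij_betw[OF assms, of "\<lambda>x. (cmod (f x))\<^sup>2"]
  by simp_all

text \<open>The Neumann series converges pointwise, so no completeness of the sequence space is needed.\<close>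

lemma neumann_series:
  fixes T :: "('i \<Rightarrow> complex) \<Rightarrow> 'i \<Rightarrow> complex"
  assumes add: "\<And>f g. T (\<lambda>x. f x + g x) = (\<lambda>x. T f x + T g x)"
    and cont: "\<And>g f x. (\<And>y. (\<lambda>n. g n y) \<longlonglongrightarrow> f y) \<Longrightarrow> (\<lambda>n. T (g n) x) \<longlonglongrightarrow> T f x"
    and T: "\<And>f. sq_summable f \<Longrightarrow> sq_summable (T f)"
      "\<And>f. sq_summable f \<Longrightarrow> sq_norm (T f) \<le> q * sq_norm f"
    and q: "0 \<le> q" "q < 1" and h: "sq_summable h"
  obtains f where "sq_summable f" "\<And>x. f x - T f x = h x"
proof -
  define u where "u n = (T ^^ n) h" for n
  have u: "sq_summable (u n) \<and> sq_norm (u n) \<le> q ^ n * sq_norm h" for n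
  proof (induction n)
    case (Suc n)
    have "sq_norm (T (u n)) \<le> q * (q ^ n * sq_norm h)"
      using T(2)[of "u n"] Suc q by (meson mult_left_mono order_trans)
    then show ?case using Suc T(1)[of "u n"] by (simp add: u_def mult.assoc)
  qed (simp add: u_def h)
  define S where "S n x = (\<Sum>k<n. u k x)" for n x
  have T0: "T (\<lambda>x. 0) = (\<lambda>x. 0)"
    using add[of "\<lambda>x. 0" "\<lambda>x. 0"] by (simp add: fun_eq_iff)
  \<comment> \<open>Applying \<open>T\<close> shifts the partial sum by one term; the pointwise
    limit of this identity is the equation \<open>f x - T f x = h x\<close>.\<close>
  have TS: "T (S n) x = S (Suc n) x - h x" for n x
  proof (induction n arbitrary: x)
    case 0
    then show ?case using T0 by (simp add: S_def u_def fun_eq_iff)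
  next
    case (Suc n)
    have "S (Suc n) = (\<lambda>x. S n x + u n x)" by (simp add: S_def fun_eq_iff)
    then have "T (S (Suc n)) x = T (S n) x + T (u n) x" by (simp add: add)
    also have "\<dots> = S (Suc (Suc n)) x - h x"
      by (simp add: Suc S_def) (simp add: u_def)
    finally show ?case .
  qed
  define f where "f x = (\<Sum>k. u k x)" for x
  have "summable (\<lambda>k. u k x)" for x
  proof (rule summable_comparison_test')
    show "summable (\<lambda>k. q ^ k * sq_norm h)"
      using q by (intro summable_mult2 summable_geometric) auto
    show "norm (u k x) \<le> q ^ k * sq_norm h" for k
      using u[of k] cmod_le_sq_norm[of "u k" x] by linarith
  qed
  then have S_lim: "(\<lambda>n. S n x) \<longlonglongrightarrow> f x" for x
    unfolding S_def f_def by (rule summable_LIMSEQ)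
  have "f x - T f x = h x" for x
  proof -
    have "(\<lambda>n. T (S n) x) \<longlonglongrightarrow> T f x" by (rule cont) (rule S_lim)
    moreover have "(\<lambda>n. S (Suc n) x - h x) \<longlonglongrightarrow> f x - h x"
      using S_lim by (intro tendsto_intros LIMSEQ_Suc)
    ultimately have "T f x = f x - h x"
      unfolding TS using LIMSEQ_unique by blast
    then show ?thesis by simp
  qed
  \<comment> \<open>On a finite set the partial sums obey a geometric bound independent of
    \<open>n\<close>, and such a bound survives the pointwise limit.\<close>
  moreover have "sq_summable f"
  proof (rule sq_summableI_bounded)
    fix F :: "'i set" assume F: "finite F"
    have "L2_set (\<lambda>x. cmod (S n x)) F \<le> sq_norm h / (1 - q)" for n
    proof -
      have "L2_set (\<lambda>x. cmod (S n x)) F \<le> sq_norm (S n)"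
        unfolding S_def using u F by (intro L2_set_le_sq_norm sq_summable_sum) auto
      also have "\<dots> \<le> (\<Sum>k<n. sq_norm (u k))"
        unfolding S_def using u by (intro sq_summable_sum) auto
      also have "\<dots> \<le> (\<Sum>k<n. q ^ k * sq_norm h)"
        using u by (intro sum_mono) auto
      also have "\<dots> = (\<Sum>k<n. q ^ k) * sq_norm h" by (simp add: sum_distrib_right)
      also have "\<dots> \<le> (1 / (1 - q)) * sq_norm h"
        using q sum_le_suminf[of "\<lambda>k. q ^ k" "{..<n}"]
        by (intro mult_right_mono) (auto simp: suminf_geometric)
      finally show ?thesis by simp
    qed
    moreover have "(\<lambda>n. L2_set (\<lambda>x. cmod (S n x)) F) \<longlonglongrightarrow> L2_set (\<lambda>x. cmod (f x)) F"
      unfolding L2_set_def by (intro tendsto_intros S_lim)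
    ultimately show "L2_set (\<lambda>x. cmod (f x)) F \<le> sq_norm h / (1 - q)"
      by (intro LIMSEQ_le_const2) auto
  qed
  ultimately show ?thesis by (intro that)
qed

section \<open>The adjacency operator and its resolvent\<close>

definition adj :: "(int^'d::finite \<Rightarrow> complex) \<Rightarrow> int^'d \<Rightarrow> complex" where
  "adj f x = (\<Sum>s\<in>UNIV. f (x + axis s 1) + f (x - axis s 1))"

lemma bij_add_const: "bij (\<lambda>x::'a::ab_group_add. x + c)" "bij (\<lambda>x::'a::ab_group_add. x - c)"
proof -
  show "bij (\<lambda>x::'a. x + c)" by (rule o_bij[of "\<lambda>x. x - c"]) (auto simp: fun_eq_iff)
  show "bij (\<lambda>x::'a. x - c)" by (rule o_bij[of "\<lambda>x. x + c"]) (auto simp: fun_eq_iff)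
qed

text \<open>The operator is a sum of 2 d translations, each of which preserves the norm.\<close>

lemma sq_summable_adj:
  fixes f :: "int^'d::finite \<Rightarrow> complex"
  assumes "sq_summable f"
  shows "sq_summable (adj f)" "sq_norm (adj f) \<le> 2 * real CARD('d) * sq_norm f"
proof -
  have sh: "sq_summable (\<lambda>x. f (x + axis s 1))" "sq_norm (\<lambda>x. f (x + axis s 1)) = sq_norm f"
    "sq_summable (\<lambda>x. f (x - axis s 1))" "sq_norm (\<lambda>x. f (x - axis s 1)) = sq_norm f" for s
    using assms by (simp_all add: sq_summable_reindex[OF bij_add_const(1), of f]
      sq_summable_reindex[OF bij_add_const(2), of f])
  have a: "sq_summable (\<lambda>x. f (x + axis s 1) + f (x - axis s 1))"
     "sq_norm (\<lambda>x. f (x + axis s 1) + f (x - axis s 1)) \<le> 2 * sq_norm f" for s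
    using sq_summable_add[OF sh(1,3)[of s]] by (simp_all add: sh)
  show "sq_summable (adj f)"
    unfolding adj_def by (intro sq_summable_sum a)
  have "sq_norm (adj f) \<le> (\<Sum>s\<in>(UNIV::'d set). sq_norm (\<lambda>x. f (x + axis s 1) + f (x - axis s 1)))"
    unfolding adj_def by (intro sq_summable_sum a)
  also have "\<dots> \<le> (\<Sum>s\<in>(UNIV::'d set). 2 * sq_norm f)"
    by (intro sum_mono a)
  finally show "sq_norm (adj f) \<le> 2 * real CARD('d) * sq_norm f" by simp
qed

lemma adj_add: "adj (\<lambda>x. f x + g x) = (\<lambda>x. adj f x + adj g x)"
  by (simp add: adj_def fun_eq_iff sum.distrib algebra_simps)

lemma has_sum_finite_sum:
  fixes f :: "'i \<Rightarrow> 'a \<Rightarrow> 'b::topological_comm_monoid_add"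
  assumes "\<And>i. i \<in> I \<Longrightarrow> (f i has_sum S i) A"
  shows "((\<lambda>x. \<Sum>i\<in>I. f i x) has_sum (\<Sum>i\<in>I. S i)) A"
  using assms by (induction I rule: infinite_finite_induct) (auto intro: has_sum_add has_sum_0)

text \<open>This is the only consequence of the symmetry of the adjacency operator that is needed.\<close>

lemma has_sum_Im_adj:
  fixes f :: "int^'d::finite \<Rightarrow> complex"
  assumes "sq_summable f"
  shows "((\<lambda>x. Im (adj f x * cnj (f x))) has_sum 0) UNIV"
proof -
  \<comment> \<open>The backward neighbour contributes Im (f (x - e) cnj (f x)), which is
    \<open>- \<psi> s (x - axis s 1)\<close> because conjugation flips the imaginary part. Each axis
    thus yields a summable function minus its own translate, and the sum of that is 0.\<close>
  define \<psi> where "\<psi> s x = Im (f (x + axis s 1) * cnj (f x))" for s x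
  have "(\<lambda>x. (cmod (f (x + axis s 1)))\<^sup>2 + (cmod (f x))\<^sup>2) summable_on UNIV" for s
  proof (rule summable_on_add)
    show "(\<lambda>x. (cmod (f x))\<^sup>2) summable_on UNIV"
      using assms unfolding sq_summable_def .
    show "(\<lambda>x. (cmod (f (x + axis s 1)))\<^sup>2) summable_on UNIV"
      using iffD2[OF sq_summable_reindex(1)[OF bij_add_const(1), of f "axis s 1"] assms]
      unfolding sq_summable_def .
  qed
  then have "(\<lambda>x. norm (\<psi> s x)) summable_on UNIV" for s
  proof (rule summable_on_comparison_test)
    fix x
    have "\<bar>\<psi> s x\<bar> \<le> cmod (f (x + axis s 1)) * cmod (f x)"
      unfolding \<psi>_def by (metis abs_Im_le_cmod complex_mod_cnj norm_mult)
    also have "\<dots> \<le> (cmod (f (x + axis s 1)))\<^sup>2 + (cmod (f x))\<^sup>2"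
      using sum_squares_bound[of "cmod (f (x + axis s 1))" "cmod (f x)"]
        mult_nonneg_nonneg[OF norm_ge_zero norm_ge_zero, of "f (x + axis s 1)" "f x"] by linarith
    finally show "norm (\<psi> s x) \<le> (cmod (f (x + axis s 1)))\<^sup>2 + (cmod (f x))\<^sup>2" by simp
  qed auto
  then have \<psi>: "(\<psi> s has_sum infsum (\<psi> s) UNIV) UNIV" for s
    by (rule has_sum_infsum[OF abs_summable_summable])
  have "((\<lambda>x. \<psi> s (x - axis s 1)) has_sum infsum (\<psi> s) UNIV) UNIV" for s
    using \<psi>[of s] has_sum_reindex_bij_betw[OF bij_add_const(2)[of "axis s 1"],
      where f = "\<psi> s" and S = "infsum (\<psi> s) UNIV"] by simp
  then have "((\<lambda>x. \<psi> s x + - \<psi> s (x - axis s 1)) has_sum infsum (\<psi> s) UNIV + - infsum (\<psi> s) UNIV) UNIV" for s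
    by (intro has_sum_add[OF \<psi>] iffD2[OF has_sum_uminus]) simp
  then have d: "((\<lambda>x. \<psi> s x - \<psi> s (x - axis s 1)) has_sum 0) UNIV" for s by simp
  have "((\<lambda>x. \<Sum>s\<in>UNIV. \<psi> s x - \<psi> s (x - axis s 1)) has_sum (\<Sum>s\<in>(UNIV::'d set). 0)) UNIV"
    by (rule has_sum_finite_sum[OF d])
  moreover have "(\<Sum>s\<in>UNIV. \<psi> s x - \<psi> s (x - axis s 1)) = Im (adj f x * cnj (f x))" for x
    unfolding \<psi>_def adj_def sum_distrib_right Im_sum
    by (intro sum.cong) (simp_all add: algebra_simps)
  ultimately show ?thesis by simp
qed

text \<open>The cross term in the square of |B x + i t f x| is 2 t Im (A f cnj f), since r |f|^2 is
  real, and it sums to 0. What remains is Pythagoras, with \<open>M\<close> as a bound for the norm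
  of A - r.\<close>

lemma adj_shift_norm:
  fixes f :: "int^'d::finite \<Rightarrow> complex" and r t :: real
  assumes f: "sq_summable f"
  defines "M \<equiv> 2 * real CARD('d) + \<bar>r\<bar>"
  defines "B \<equiv> \<lambda>x. adj f x - of_real r * f x"
  shows "sq_summable (\<lambda>x. B x + \<i> * of_real t * f x)"
    "sq_norm (\<lambda>x. B x + \<i> * of_real t * f x) \<le> sqrt (M\<^sup>2 + t\<^sup>2) * sq_norm f"
proof -
  have B: "sq_summable B" "sq_norm B \<le> M * sq_norm f"
    using sq_summable_diff[OF sq_summable_adj(1)[OF f] sq_summable_cmult[OF f, of "of_real r"]]
      sq_summable_adj(2)[OF f]
    by (auto simp: B_def M_def sq_norm_cmult algebra_simps)
  show "sq_summable (\<lambda>x. B x + \<i> * of_real t * f x)"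
    by (intro sq_summable_add sq_summable_cmult B f)
  have pt: "(cmod (B x + \<i> * of_real t * f x))\<^sup>2 =
      ((cmod (B x))\<^sup>2 + t\<^sup>2 * (cmod (f x))\<^sup>2) + 2 * t * Im (adj f x * cnj (f x))" for x
    unfolding cmod_power2 B_def by (simp add: algebra_simps power2_eq_square)
  have "((\<lambda>x. ((cmod (B x))\<^sup>2 + t\<^sup>2 * (cmod (f x))\<^sup>2) + 2 * t * Im (adj f x * cnj (f x)))
     has_sum (((sq_norm B)\<^sup>2 + t\<^sup>2 * (sq_norm f)\<^sup>2) + 2 * t * 0)) UNIV"
    using B(1) f unfolding sq_norm_power2 sq_summable_def
    by (intro has_sum_add has_sum_cmult_right has_sum_Im_adj f has_sum_infsum)
  then have "(sq_norm (\<lambda>x. B x + \<i> * of_real t * f x))\<^sup>2 = (sq_norm B)\<^sup>2 + t\<^sup>2 * (sq_norm f)\<^sup>2"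
    unfolding pt[symmetric] sq_norm_power2 by (simp add: infsumI)
  also have "\<dots> \<le> (M * sq_norm f)\<^sup>2 + t\<^sup>2 * (sq_norm f)\<^sup>2"
    using B(2) by (intro add_right_mono power_mono) auto
  also have "\<dots> = (sqrt (M\<^sup>2 + t\<^sup>2) * sq_norm f)\<^sup>2"
    by (simp add: power_mult_distrib algebra_simps)
  finally show "sq_norm (\<lambda>x. B x + \<i> * of_real t * f x) \<le> sqrt (M\<^sup>2 + t\<^sup>2) * sq_norm f"
    by (rule power2_le_imp_le) simp
qed

text \<open>
  For non-real \<open>\<mu> = r + i y\<close>, the contraction is \<open>(A - r + i t) / (i (y + t))\<close> with \<open>t\<close> large and of
  the sign of \<open>y\<close>; by symmetry of \<open>A - r\<close> the norm of the numerator is at most \<open>sqrt (M\<^sup>2 + t\<^sup>2)\<close>.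
\<close>

lemma adj_resolvent_contraction:
  fixes \<mu> :: complex
  assumes \<mu>: "\<mu> \<notin> complex_of_real ` {- 2 * real CARD('d::finite) .. 2 * real CARD('d)}"
  obtains c q where "c \<noteq> 0" "0 \<le> q" "q < 1"
    "\<And>f :: int^'d \<Rightarrow> complex. sq_summable f \<Longrightarrow> sq_norm (\<lambda>x. f x + c * (adj f x - \<mu> * f x)) \<le> q * sq_norm f"
proof (cases "Im \<mu> = 0")
  case True
  let ?D = "2 * real CARD('d)"
  have m: "\<mu> = of_real (Re \<mu>)" using True by (simp add: complex_eq_iff)
  have D0: "?D > 0" by simp
  have big: "cmod \<mu> > ?D"
  proof (rule ccontr)
    assume "\<not> ?thesis"
    then have "Re \<mu> \<in> {- 2 * real CARD('d) .. ?D}" using abs_Re_le_cmod[of \<mu>] by auto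
    then show False using \<mu> m by (metis imageI)
  qed
  then have n0: "\<mu> \<noteq> 0" by auto
  show ?thesis
  \<comment> \<open>With this factor the identity cancels, and what is left is A / \<mu>, of norm at
    most 2 d / |\<mu>|.\<close>
  proof (rule that[of "1 / \<mu>" "?D / cmod \<mu>"])
    fix f :: "int^'d \<Rightarrow> complex" assume f: "sq_summable f"
    have "(\<lambda>x. f x + 1 / \<mu> * (adj f x - \<mu> * f x)) = (\<lambda>x. (1 / \<mu>) * adj f x)"
      using n0 by (simp add: fun_eq_iff field_simps)
    then show "sq_norm (\<lambda>x. f x + 1 / \<mu> * (adj f x - \<mu> * f x)) \<le> ?D / cmod \<mu> * sq_norm f"
      using sq_summable_adj(2)[OF f] n0 by (simp only: sq_norm_cmult) (simp add: norm_divide divide_right_mono)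
  qed (use big D0 n0 in \<open>auto simp: field_simps\<close>)
next
  case False
  define r y where "r = Re \<mu>" and "y = Im \<mu>"
  define M where "M = 2 * real CARD('d) + \<bar>r\<bar>"
  \<comment> \<open>Chosen so that 2 y t = M^2; then (y + t)^2 exceeds M^2 + t^2 by exactly
    y^2.\<close>
  define t where "t = M\<^sup>2 / (2 * y)"
  have y: "y \<noteq> 0" using False by (simp add: y_def)
  have mu: "\<mu> = of_real r + \<i> * of_real y" by (simp add: complex_eq_iff r_def y_def)
  have eq: "(y + t)\<^sup>2 = y\<^sup>2 + M\<^sup>2 + t\<^sup>2"
    using y by (simp add: t_def power2_sum)
  then have lt: "M\<^sup>2 + t\<^sup>2 < (y + t)\<^sup>2" using y by simp
  then have yt: "y + t \<noteq> 0"
    by (metis add_nonneg_nonneg not_less power_zero_numeral zero_le_power2)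
  define c where "c = 1 / (\<i> * of_real (y + t))"
  define q where "q = sqrt (M\<^sup>2 + t\<^sup>2) / \<bar>y + t\<bar>"
  show ?thesis
  proof (rule that[of c q])
    show "c \<noteq> 0" using yt by (auto simp: c_def simp flip: of_real_add)
    show "0 \<le> q" by (simp add: q_def)
    have "sqrt (M\<^sup>2 + t\<^sup>2) < sqrt ((y + t)\<^sup>2)" using lt by (rule real_sqrt_less_mono)
    then show "q < 1" using yt by (simp add: q_def)
  next
    fix f :: "int^'d \<Rightarrow> complex" assume f: "sq_summable f"
    have "c * (\<i> * of_real (y + t)) = 1" using yt by (simp add: c_def del: of_real_add)
    then have "f x + c * (adj f x - \<mu> * f x) =
       c * ((adj f x - of_real r * f x) + \<i> * of_real t * f x)" for x
      unfolding mu by (simp add: algebra_simps) (metis (no_types) distrib_left mult.assoc mult.commute mult_1)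
    then have e: "sq_norm (\<lambda>x. f x + c * (adj f x - \<mu> * f x)) = cmod c *
       sq_norm (\<lambda>x. (adj f x - of_real r * f x) + \<i> * of_real t * f x)"
      by (simp only: sq_norm_cmult)
    have "cmod c = 1 / \<bar>y + t\<bar>" 
      unfolding c_def norm_divide norm_mult norm_of_real by simp
    then show "sq_norm (\<lambda>x. f x + c * (adj f x - \<mu> * f x)) \<le> q * sq_norm f"
      unfolding e q_def using adj_shift_norm(2)[OF f, of r t, folded M_def]
      by (simp add: divide_right_mono)
  qed
qed

text \<open>Let T = 1 + c (A - \<mu>) be the contraction. The lower bound is the triangle inequality
  for f = T f - c (A - \<mu>) f, and solving (A - \<mu>) f = h amounts to f - T f = - c h, which the
  Neumann series does.\<close>

lemma adj_resolvent:
  fixes \<mu> :: complex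
  assumes \<mu>: "\<mu> \<notin> complex_of_real ` {- 2 * real CARD('d::finite) .. 2 * real CARD('d)}"
  obtains C where "0 \<le> C"
    "\<And>f :: int^'d \<Rightarrow> complex. sq_summable f \<Longrightarrow> sq_norm f \<le> C * sq_norm (\<lambda>x. adj f x - \<mu> * f x)"
    "\<And>h :: int^'d \<Rightarrow> complex. sq_summable h \<Longrightarrow> \<exists>f. sq_summable f \<and> (\<forall>x. adj f x - \<mu> * f x = h x)"
proof -
  obtain c q where cq: "c \<noteq> 0" "0 \<le> q" "q < 1" and
    contr: "\<And>f :: int^'d \<Rightarrow> complex. sq_summable f \<Longrightarrow>
      sq_norm (\<lambda>x. f x + c * (adj f x - \<mu> * f x)) \<le> q * sq_norm f"
    using adj_resolvent_contraction[OF \<mu>] by blast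
  define T where "T f = (\<lambda>x. f x + c * (adj f x - \<mu> * f x))" for f :: "int^'d \<Rightarrow> complex"
  have Ts: "sq_summable (T f)" "sq_summable (\<lambda>x. adj f x - \<mu> * f x)" if "sq_summable f" for f
    unfolding T_def using that
    by (intro sq_summable_add sq_summable_cmult sq_summable_diff sq_summable_adj that)+
  show ?thesis
  proof
    show "0 \<le> cmod c / (1 - q)" using cq by simp
    fix f :: "int^'d \<Rightarrow> complex" assume f: "sq_summable f"
    let ?g = "\<lambda>x. adj f x - \<mu> * f x"
    have "f = (\<lambda>x. T f x - c * ?g x)" by (simp add: T_def)
    then have "sq_norm f \<le> sq_norm (T f) + sq_norm (\<lambda>x. c * ?g x)"
      using sq_summable_diff(2)[OF Ts(1)[OF f] sq_summable_cmult[OF Ts(2)[OF f], of c]] by simp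
    then have "(1 - q) * sq_norm f \<le> cmod c * sq_norm ?g"
      using contr[OF f] unfolding T_def sq_norm_cmult by (simp add: algebra_simps)
    then show "sq_norm f \<le> cmod c / (1 - q) * sq_norm ?g"
      using cq by (simp add: field_simps)
  next
    fix h :: "int^'d \<Rightarrow> complex" assume h: "sq_summable h"
    obtain f where f: "sq_summable f" "\<And>x. f x - T f x = - c * h x"
    proof (rule neumann_series[of T q "\<lambda>x. - c * h x"])
      show "T (\<lambda>x. f x + g x) = (\<lambda>x. T f x + T g x)" for f g
        by (simp add: T_def adj_add algebra_simps fun_eq_iff)
      show "(\<lambda>n. T (g n) x) \<longlonglongrightarrow> T f x" if "\<And>y. (\<lambda>n. g n y) \<longlonglongrightarrow> f y" for g f x
        unfolding T_def adj_def by (intro tendsto_intros that)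
      show "sq_summable (\<lambda>x. - c * h x)" by (intro sq_summable_cmult h)
    qed (use cq contr Ts in \<open>auto simp: T_def\<close>)
    then have "adj f x - \<mu> * f x = h x" for x
      using f(2)[of x] cq by (simp add: T_def)
    then show "\<exists>f. sq_summable f \<and> (\<forall>x. adj f x - \<mu> * f x = h x)" using f by blast
  qed
qed

section \<open>Approximate eigenfunctions of the adjacency operator\<close>

lemma sum_power_nat_abs_le:
  fixes r :: real
  assumes "0 \<le> r" "r < 1" "finite T"
  shows "(\<Sum>k\<in>T. r ^ nat \<bar>k\<bar>) \<le> 2 / (1 - r)"
proof -
  have *: "(\<Sum>k\<in>S. r ^ nat \<bar>k\<bar>) \<le> 1 / (1 - r)"
    if "finite S" "inj_on (\<lambda>k. nat \<bar>k\<bar>) S" for S :: "int set"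
  proof -
    have "(\<Sum>k\<in>S. r ^ nat \<bar>k\<bar>) = (\<Sum>n\<in>(\<lambda>k. nat \<bar>k\<bar>) ` S. r ^ n)"
      using that by (simp add: sum.reindex)
    also have "\<dots> \<le> (\<Sum>n. r ^ n)"
      using assms that by (intro sum_le_suminf) auto
    finally show ?thesis using assms by (simp add: suminf_geometric)
  qed
  have "T = (T \<inter> {0..}) \<union> (T \<inter> {..<0})" by auto
  then have "(\<Sum>k\<in>T. r ^ nat \<bar>k\<bar>) =
      (\<Sum>k\<in>T \<inter> {0..}. r ^ nat \<bar>k\<bar>) + (\<Sum>k\<in>T \<inter> {..<0}. r ^ nat \<bar>k\<bar>)"
  proof -
    have "sum (\<lambda>k. r ^ nat \<bar>k\<bar>) ((T \<inter> {0..}) \<union> (T \<inter> {..<0})) =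
       (\<Sum>k\<in>T \<inter> {0..}. r ^ nat \<bar>k\<bar>) + (\<Sum>k\<in>T \<inter> {..<0}. r ^ nat \<bar>k\<bar>)"
      using assms(3) by (intro sum.union_disjoint) auto
    then show ?thesis by (simp only: \<open>T = _\<close>[symmetric])
  qed
  also have "\<dots> \<le> 1 / (1 - r) + 1 / (1 - r)"
    using assms(3) by (intro add_mono *) (auto simp: inj_on_def)
  finally show ?thesis by simp
qed

text \<open>A finite set of lattice points lies in the product of its coordinate projections, and
  over a product the sum factors into one-dimensional sums with a common bound.\<close>

lemma summable_on_prod_power:
  fixes r :: real
  assumes "0 \<le> r" "r < 1"
  shows "(\<lambda>x :: int^'d::finite. \<Prod>s\<in>UNIV. r ^ nat \<bar>vec_nth x s\<bar>) summable_on UNIV"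
proof (rule nonneg_bdd_above_summable_on)
  show "bdd_above (sum (\<lambda>x :: int^'d. \<Prod>s\<in>UNIV. r ^ nat \<bar>vec_nth x s\<bar>) ` {F. F \<subseteq> UNIV \<and> finite F})"
  proof (rule bdd_aboveI2)
    fix F :: "(int^'d) set" assume "F \<in> {F. F \<subseteq> UNIV \<and> finite F}"
    then have F: "finite F" by simp
    let ?T = "\<lambda>s. (\<lambda>x. vec_nth x s) ` F"
    have "(\<Sum>x\<in>F. \<Prod>s\<in>UNIV. r ^ nat \<bar>vec_nth x s\<bar>) =
        (\<Sum>g\<in>vec_nth ` F. \<Prod>s\<in>UNIV. r ^ nat \<bar>g s\<bar>)"
      by (subst sum.reindex) (auto simp: inj_on_def vec_nth_inject)
    also have "\<dots> \<le> (\<Sum>g\<in>PiE UNIV ?T. \<Prod>s\<in>UNIV. r ^ nat \<bar>g s\<bar>)"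
      using F assms by (intro sum_mono2 finite_PiE) (auto intro!: prod_nonneg)
    also have "\<dots> = (\<Prod>s\<in>UNIV. \<Sum>k\<in>?T s. r ^ nat \<bar>k\<bar>)"
      using F by (subst prod_sum_PiE) auto
    also have "\<dots> \<le> (\<Prod>s\<in>(UNIV :: 'd set). 2 / (1 - r))"
      using F assms by (intro prod_mono) (auto intro!: sum_nonneg sum_power_nat_abs_le)
    finally show "(\<Sum>x\<in>F. \<Prod>s\<in>UNIV. r ^ nat \<bar>vec_nth x s\<bar>) \<le> (\<Prod>s\<in>(UNIV :: 'd set). 2 / (1 - r))" .
  qed
qed (use assms in \<open>auto intro!: prod_nonneg\<close>)

lemma axis_sum_eq: "(\<Sum>u\<in>UNIV. c * of_int (vec_nth (axis s (1::int)) u)) = (c :: 'a::ring_1)"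
proof -
  have "(\<Sum>u\<in>UNIV. c * of_int (vec_nth (axis s (1::int)) u)) = (\<Sum>u\<in>UNIV. if u = s then c else 0)"
    by (intro sum.cong) (auto simp: axis_def)
  then show ?thesis by simp
qed

text \<open>The approximate eigenfunctions are plane waves with an exponentially decaying envelope.\<close>

lemma adj_not_bounded_below:
  assumes \<mu>: "\<mu> \<in> {- 2 * real CARD('d::finite) .. 2 * real CARD('d)}"
  shows "\<exists>f :: int^'d \<Rightarrow> complex. sq_summable f \<and>
    C * sq_norm (\<lambda>x. adj f x - of_real \<mu> * f x) < sq_norm f"
proof -
  let ?D = "2 * real CARD('d)"
  \<comment> \<open>The same phase is used along every axis, so that the plane wave solves the
    eigenvalue equation for 2 d cos \<tau> = \<mu> exactly.\<close>
  define \<tau> where "\<tau> = arccos (\<mu> / ?D)"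
  have D0: "?D > 0" by simp
  have "cos \<tau> = \<mu> / ?D"
    unfolding \<tau>_def using \<mu> D0 by (intro cos_arccos) (auto simp: field_simps simp del: zero_less_card_finite)
  then have cos\<tau>: "\<mu> = (\<Sum>s\<in>(UNIV::'d set). 2 * cos \<tau>)" by simp
  \<comment> \<open>The envelope will spoil the eigenvalue equation by at most 2 d (exp \<epsilon> -
    1) |f x|, so \<epsilon> is taken small enough to beat the given \<open>C\<close>.\<close>
  have "((\<lambda>\<epsilon>. \<bar>C\<bar> * (?D * (exp \<epsilon> - 1))) \<longlongrightarrow> \<bar>C\<bar> * (?D * (exp 0 - 1))) (at_right (0::real))"
    by (intro tendsto_intros)
  then have "\<forall>\<^sub>F \<epsilon> in at_right 0. \<bar>C\<bar> * (?D * (exp \<epsilon> - 1)) < 1"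
    by (intro order_tendstoD) auto
  moreover have "\<forall>\<^sub>F \<epsilon> in at_right (0::real). \<epsilon> > 0" by (simp add: eventually_at_right_less)
  ultimately have "\<forall>\<^sub>F \<epsilon> in at_right (0::real). \<epsilon> > 0 \<and> \<bar>C\<bar> * (?D * (exp \<epsilon> - 1)) < 1"
    by eventually_elim auto
  then obtain \<epsilon> :: real where \<epsilon>: "\<epsilon> > 0" "\<bar>C\<bar> * (?D * (exp \<epsilon> - 1)) < 1"
    by (metis (mono_tags, lifting) eventually_happens trivial_limit_at_right_real)
  define \<Phi> where "\<Phi> x = (\<Sum>s\<in>UNIV. \<tau> * of_int (vec_nth x s))" for x :: "int^'d"
  \<comment> \<open>The l1 norm makes |f x|^2 a product over the coordinates, hence summable, and it
    changes by at most 1 between neighbours.\<close>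
  define N where "N x = (\<Sum>s\<in>UNIV. real_of_int \<bar>vec_nth x s\<bar>)" for x :: "int^'d"
  define f where "f x = cis (\<Phi> x) * of_real (exp (- \<epsilon> * N x))" for x
  have cf: "cmod (f x) = exp (- \<epsilon> * N x)" for x by (simp add: f_def norm_mult)
  have "(cmod (f x))\<^sup>2 = (\<Prod>s\<in>UNIV. exp (- 2 * \<epsilon>) ^ nat \<bar>vec_nth x s\<bar>)" for x
  proof -
    have "(cmod (f x))\<^sup>2 = exp (\<Sum>s\<in>UNIV. - 2 * \<epsilon> * of_int \<bar>vec_nth x s\<bar>)"
      by (simp add: cf N_def sum_distrib_left sum_negf flip: exp_double) (simp add: algebra_simps)
    also have "\<dots> = (\<Prod>s\<in>UNIV. exp (- 2 * \<epsilon>) ^ nat \<bar>vec_nth x s\<bar>)"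
      by (simp add: exp_sum flip: exp_of_nat_mult) (simp add: algebra_simps)
    finally show ?thesis .
  qed
  then have f: "sq_summable f"
    unfolding sq_summable_def using \<epsilon> by (simp add: summable_on_prod_power)
  have \<Phi>1: "\<Phi> (x + axis s 1) = \<Phi> x + \<tau>" "\<Phi> (x - axis s 1) = \<Phi> x - \<tau>" for x s
    using axis_sum_eq[of \<tau> s]
    by (simp_all add: \<Phi>_def distrib_left right_diff_distrib sum.distrib sum_subtractf)
  have N1: "\<bar>N y - N x\<bar> \<le> 1" if "y = x + axis s 1 \<or> y = x - axis s 1" for x y s
  proof -
    have "\<bar>N y - N x\<bar> \<le> (\<Sum>u\<in>UNIV. \<bar>real_of_int \<bar>vec_nth y u\<bar> - real_of_int \<bar>vec_nth x u\<bar>\<bar>)"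
      unfolding N_def sum_subtractf[symmetric] by (rule sum_abs)
    also have "\<dots> \<le> (\<Sum>u\<in>UNIV. if u = s then 1 else 0)"
      using that by (intro sum_mono) (auto simp: axis_def)
    finally show ?thesis by simp
  qed
  have expb: "\<bar>exp (- \<epsilon> * N y) - exp (- \<epsilon> * N x)\<bar> \<le> (exp \<epsilon> - 1) * cmod (f x)"
    if "\<bar>N y - N x\<bar> \<le> 1" for x y
  proof -
    have "exp (- \<epsilon> * N y) - exp (- \<epsilon> * N x) = (exp (\<epsilon> * (N x - N y)) - 1) * cmod (f x)"
      unfolding cf by (simp add: algebra_simps flip: exp_add)
    moreover have "\<bar>exp (\<epsilon> * (N x - N y)) - 1\<bar> \<le> exp \<epsilon> - 1"
    proof -
      have e: "\<epsilon> * (N x - N y) \<le> \<epsilon>" "- \<epsilon> \<le> \<epsilon> * (N x - N y)"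
        using that \<epsilon> by (auto simp: abs_le_iff) (smt (verit) mult_left_le mult_minus_right)+
      \<comment> \<open>The downward deviation 1 - exp (-\<epsilon>) is thereby at most the upward
        one, exp \<epsilon> - 1.\<close>
      have "exp (-\<epsilon>) + exp \<epsilon> \<ge> 2"
        using exp_ge_add_one_self[of \<epsilon>] exp_ge_add_one_self[of "-\<epsilon>"] by linarith
      then show ?thesis using e by (smt (verit) exp_le_cancel_iff)
    qed
    ultimately show ?thesis by (simp add: abs_mult mult_right_mono)
  qed
  have "cmod (adj f x - of_real \<mu> * f x) \<le> ?D * (exp \<epsilon> - 1) * cmod (f x)" for x
  proof -
    have c2: "of_real (2 * cos \<tau>) = cis \<tau> + cis (- \<tau>)" by (simp add: complex_eq_iff)
    have d1: "f (x + axis s 1) - cis \<tau> * f x =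
        cis (\<Phi> x + \<tau>) * of_real (exp (- \<epsilon> * N (x + axis s 1)) - exp (- \<epsilon> * N x))" for s
      unfolding f_def \<Phi>1 cis_mult[symmetric] of_real_diff by (simp add: algebra_simps)
    have d2: "f (x - axis s 1) - cis (- \<tau>) * f x =
        cis (\<Phi> x - \<tau>) * of_real (exp (- \<epsilon> * N (x - axis s 1)) - exp (- \<epsilon> * N x))" for s
      unfolding f_def \<Phi>1 diff_conv_add_uminus[of "\<Phi> x"] cis_mult[symmetric] of_real_diff
      by (simp add: algebra_simps)
    have "adj f x - of_real \<mu> * f x = (\<Sum>s\<in>UNIV. (f (x + axis s 1) + f (x - axis s 1)) - of_real (2 * cos \<tau>) * f x)"
      unfolding adj_def cos\<tau> of_real_sum sum_distrib_right sum_subtractf ..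
    also have "\<dots> = (\<Sum>s\<in>UNIV. (f (x + axis s 1) - cis \<tau> * f x) + (f (x - axis s 1) - cis (- \<tau>) * f x))"
      unfolding c2 by (intro sum.cong) (auto simp: algebra_simps)
    also have "cmod \<dots> \<le> (\<Sum>s\<in>(UNIV::'d set). 2 * ((exp \<epsilon> - 1) * cmod (f x)))"
    proof (rule sum_norm_le)
      fix s
      have "cmod (f (x + axis s 1) - cis \<tau> * f x) \<le> (exp \<epsilon> - 1) * cmod (f x)"
        unfolding d1 norm_mult norm_cis norm_of_real using expb[OF N1[of "x + axis s 1" x s]] by simp
      moreover have "cmod (f (x - axis s 1) - cis (- \<tau>) * f x) \<le> (exp \<epsilon> - 1) * cmod (f x)"
        unfolding d2 norm_mult norm_cis norm_of_real using expb[OF N1[of "x - axis s 1" x s]] by simp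
      ultimately show "cmod ((f (x + axis s 1) - cis \<tau> * f x) + (f (x - axis s 1) - cis (- \<tau>) * f x))
          \<le> 2 * ((exp \<epsilon> - 1) * cmod (f x))"
        using norm_triangle_ineq[of "f (x + axis s 1) - cis \<tau> * f x" "f (x - axis s 1) - cis (- \<tau>) * f x"]
        by linarith
    qed
    also have "\<dots> = ?D * (exp \<epsilon> - 1) * cmod (f x)" by simp
    finally show ?thesis .
  qed
  moreover define K where "K = ?D * (exp \<epsilon> - 1)"
  ultimately have "cmod (adj f x - of_real \<mu> * f x) \<le> K * cmod (f x)" for x by simp
  moreover have K: "0 \<le> K" "\<bar>C\<bar> * K < 1" using \<epsilon> by (auto simp: K_def)
  ultimately have *: "cmod (adj f x - of_real \<mu> * f x) \<le> cmod (of_real K * f x)" for x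
    by (simp add: norm_mult)
  have "sq_norm (\<lambda>x. adj f x - of_real \<mu> * f x) \<le> sq_norm (\<lambda>x. of_real K * f x)"
  proof (rule sq_summableI_bounded)
    fix F :: "(int^'d) set" assume "finite F"
    with L2_set_le_sq_norm[OF sq_summable_cmult[OF f]]
    have "L2_set (\<lambda>x. cmod (of_real K * f x)) F \<le> sq_norm (\<lambda>x. of_real K * f x)" .
    moreover have "L2_set (\<lambda>x. cmod (adj f x - of_real \<mu> * f x)) F \<le> L2_set (\<lambda>x. cmod (of_real K * f x)) F"
      by (intro L2_set_mono *) auto
    ultimately show "L2_set (\<lambda>x. cmod (adj f x - of_real \<mu> * f x)) F \<le> sq_norm (\<lambda>x. of_real K * f x)"
      by (rule order_trans[rotated])
  qed
  also have "\<dots> = K * sq_norm f"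
    using K by (simp add: sq_norm_cmult)
  finally have "\<bar>C\<bar> * sq_norm (\<lambda>x. adj f x - of_real \<mu> * f x) \<le> \<bar>C\<bar> * (K * sq_norm f)"
    by (intro mult_left_mono) auto
  moreover have "C * sq_norm (\<lambda>x. adj f x - of_real \<mu> * f x) \<le> \<bar>C\<bar> * sq_norm (\<lambda>x. adj f x - of_real \<mu> * f x)"
    by (intro mult_right_mono) auto
  moreover have "0 < sq_norm f"
  proof (rule less_le_trans)
    show "0 < cmod (f 0)" unfolding cf by simp
    show "cmod (f 0) \<le> sq_norm f" by (rule cmod_le_sq_norm[OF f])
  qed
  then have "\<bar>C\<bar> * (K * sq_norm f) < sq_norm f"
    using K(2) mult_strict_right_mono[of "\<bar>C\<bar> * K" 1 "sq_norm f"] by (simp add: mult.assoc)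
  ultimately have "C * sq_norm (\<lambda>x. adj f x - of_real \<mu> * f x) < sq_norm f" by linarith
  then show ?thesis using f by blast
qed

section \<open>Arrow matrices\<close>

text \<open>The shape of the Floquet matrices: a hub joined to n - 1 leaves of degree 1. The hub
  index \<open>h\<close> is a parameter because the enumeration of the fundamental vertices is an
  arbitrary choice.\<close>

definition arrow_mat :: "nat \<Rightarrow> nat \<Rightarrow> complex \<Rightarrow> complex mat" where
  "arrow_mat n h c = Matrix.mat n n (\<lambda>(i, k). if i = h \<and> k = h then c
      else if i = h \<or> k = h then - 1 else if i = k then 1 else 0)"

text \<open>Expansion along column \<open>h\<close> leaves a single cofactor, the determinant of a
  scalar matrix; the other entries of row \<open>h\<close> are arbitrary.\<close>

lemma det_scalar_off_column:
  fixes A :: "complex mat"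
  assumes A: "A \<in> carrier_mat n n" and h: "h < n"
    and col: "\<And>i. i < n \<Longrightarrow> i \<noteq> h \<Longrightarrow> A $$ (i, h) = 0"
    and off: "\<And>i j. i < n \<Longrightarrow> j < n \<Longrightarrow> i \<noteq> h \<Longrightarrow> j \<noteq> h \<Longrightarrow> A $$ (i, j) = (if i = j then x else 0)"
  shows "det A = A $$ (h, h) * x ^ (n - 1)"
proof -
  have "det A = (\<Sum>i<n. A $$ (i, h) * cofactor A i h)"
    by (rule laplace_expansion_column[OF A h])
  also have "\<dots> = (\<Sum>i\<in>{h}. A $$ (i, h) * cofactor A i h)"
    using h col by (intro sum.mono_neutral_right) auto
  also have "\<dots> = A $$ (h, h) * det (mat_delete A h h)"
    by (simp add: cofactor_def mult_2[symmetric] power_mult)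
  also have "mat_delete A h h = x \<cdot>\<^sub>m 1\<^sub>m (n - 1)"
    using A h by (intro eq_matI) (auto simp: mat_delete_def off)
  also have "det \<dots> = x ^ (n - 1)" by simp
  finally show ?thesis .
qed

text \<open>
  Off \<open>x = 1\<close>, subtracting \<open>1 / (x - 1)\<close> times every other column clears the hub column of
  \<open>x - arrow_mat n h c\<close>.
\<close>

lemma poly_char_poly_arrow_mat:
  assumes h: "h < n" and n: "n \<ge> 2" and x: "x \<noteq> 1"
  shows "poly (char_poly (arrow_mat n h c)) x =
    (x - 1) ^ (n - 2) * ((x - 1) * (x - c) - of_nat (n - 1))"
proof -
  define B where "B = - char_matrix (arrow_mat n h c) x"
  define U where "U = Matrix.mat n n (\<lambda>(i, k). if k = h then (if i = h then 1 else - 1 / (x - 1))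
      else if i = k then 1 else 0 :: complex)"
  have carr: "arrow_mat n h c \<in> carrier_mat n n" by (simp add: arrow_mat_def)
  have B: "B \<in> carrier_mat n n" unfolding B_def using carr by simp
  have U: "U \<in> carrier_mat n n" by (simp add: U_def)
  have Bij: "B $$ (i, k) = (if i = h \<and> k = h then x - c else if i = h \<or> k = h then 1
      else if i = k then x - 1 else 0)" if "i < n" "k < n" for i k
    using that by (auto simp: B_def char_matrix_def arrow_mat_def)
  have BU: "(B * U) $$ (i, k) = (\<Sum>l\<in>{0..<n}. B $$ (i, l) * U $$ (l, k))" if "i < n" "k < n" for i k
    using that B U by (simp add: scalar_prod_def)
  have BU_off: "(B * U) $$ (i, k) = B $$ (i, k)" if "i < n" "k < n" "k \<noteq> h" for i k
  proof -
    have "(\<Sum>l\<in>{0..<n}. B $$ (i, l) * U $$ (l, k)) = (\<Sum>l\<in>{0..<n}. if l = k then B $$ (i, l) else 0)"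
      using that by (intro sum.cong) (auto simp: U_def)
    then show ?thesis using that BU by simp
  qed
  have BU_col: "(B * U) $$ (i, h) = 0" if "i < n" "i \<noteq> h" for i
  proof -
    have "(\<Sum>l\<in>{0..<n}. B $$ (i, l) * U $$ (l, h)) =
        (\<Sum>l\<in>{0..<n}. (if l = h then 1 else 0) - (if l = i then 1 else 0))"
      using that h x by (intro sum.cong) (auto simp: U_def Bij field_simps)
    also have "\<dots> = 0" using that h by (simp add: sum_subtractf)
    finally show ?thesis using that h BU by simp
  qed
  \<comment> \<open>The column operation leaves at the hub the Schur complement of the leaf
    block.\<close>
  have BU_hub: "(B * U) $$ (h, h) = (x - c) - of_nat (n - 1) / (x - 1)"
  proof -
    have "(\<Sum>l\<in>{0..<n}. B $$ (h, l) * U $$ (l, h)) =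
        B $$ (h, h) * U $$ (h, h) + (\<Sum>l\<in>{0..<n} - {h}. B $$ (h, l) * U $$ (l, h))"
      using h by (intro sum.remove) auto
    also have "(\<Sum>l\<in>{0..<n} - {h}. B $$ (h, l) * U $$ (l, h)) = (\<Sum>l\<in>{0..<n} - {h}. - 1 / (x - 1))"
      using h by (intro sum.cong) (auto simp: U_def Bij)
    also have "\<dots> = - (of_nat (n - 1) / (x - 1))" using h by simp
    finally show ?thesis using h BU by (simp add: Bij U_def)
  qed
  have "det (B * U) = (B * U) $$ (h, h) * (x - 1) ^ (n - 1)"
    using B U h BU_col BU_off by (intro det_scalar_off_column) (auto simp: Bij)
  \<comment> \<open>\<open>U\<close> differs from the identity only in column \<open>h\<close>, so
    its transpose has the required zero pattern, with scalar 1.\<close>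
  moreover have "det U = 1"
  proof -
    have "det (transpose_mat U) = transpose_mat U $$ (h, h) * 1 ^ (n - 1)"
      using U h by (intro det_scalar_off_column) (auto simp: U_def)
    moreover have "transpose_mat U $$ (h, h) = 1" using h by (simp add: U_def)
    ultimately show ?thesis unfolding det_transpose[OF U] by simp
  qed
  moreover have "det (B * U) = det B * det U" by (rule det_mult[OF B U])
  ultimately have "det B = ((x - c) - of_nat (n - 1) / (x - 1)) * (x - 1) ^ (n - 1)"
    by (simp add: BU_hub)
  also have "(x - 1) ^ (n - 1) = (x - 1) * (x - 1) ^ (n - 2)"
    using n by (metis Suc_diff_le diff_Suc_1 numeral_2_eq_2 power_Suc Suc_1 diff_Suc_Suc One_nat_def)
  also have "((x - c) - of_nat (n - 1) / (x - 1)) * \<dots> =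
      (x - 1) ^ (n - 2) * ((x - 1) * (x - c) - of_nat (n - 1))"
    using x by (simp add: field_simps)
  finally show ?thesis unfolding char_poly_matrix[OF carr] B_def .
qed

text \<open>The determinant formula is available only off \<open>x = 1\<close>, but polynomials that
  agree at infinitely many points are equal. This also settles the multiplicity of the root
  1.\<close>

lemma char_poly_arrow_mat:
  assumes h: "h < n" and n: "n \<ge> 2"
    and roots: "\<And>x. (x - 1) * (x - c) - of_nat (n - 1) = (x - l) * (x - u)"
  shows "char_poly (arrow_mat n h c) = [:- 1, 1:] ^ (n - 2) * ([:- l, 1:] * [:- u, 1:])"
proof (rule ccontr)
  let ?p = "char_poly (arrow_mat n h c)" and ?q = "[:- 1, 1:] ^ (n - 2) * ([:- l, 1:] * [:- u, 1:])"
  assume "?p \<noteq> ?q"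
  then have "finite {x. poly (?p - ?q) x = 0}" by (intro poly_roots_finite) simp
  moreover have "- {1} \<subseteq> {x. poly (?p - ?q) x = 0}"
  proof
    fix x :: complex assume "x \<in> - {1}"
    then have "poly ?p x = (x - 1) ^ (n - 2) * ((x - l) * (x - u))"
      using poly_char_poly_arrow_mat[OF h n, of x c] by (simp only: roots) simp
    then show "x \<in> {x. poly (?p - ?q) x = 0}"
      by (simp only: mem_Collect_eq poly_diff poly_mult poly_power) (simp add: algebra_simps)
  qed
  ultimately have "finite (- {1 :: complex})" by (rule rev_finite_subset)
  then show False using infinite_UNIV_char_0[where ?'a = complex] by (simp add: finite_compl)
qed

section \<open>Eigenvalue lists from characteristic polynomials\<close>

lemma order_prod_linear:
  fixes x :: "'a::idom"
  shows "Polynomial.order x (\<Prod>y\<leftarrow>ys. [:- y, 1:]) = count (mset ys) x"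
proof (induction ys)
  case (Cons y ys)
  have "(\<Prod>y\<leftarrow>zs. [:- y, 1:]) \<noteq> 0" for zs :: "'a list" by (auto simp: prod_list_zero_iff)
  from this[of "y # ys"]
  have "Polynomial.order x (\<Prod>y\<leftarrow>y # ys. [:- y, 1:]) =
      Polynomial.order x [:- y, 1:] + Polynomial.order x (\<Prod>y\<leftarrow>ys. [:- y, 1:])"
    unfolding list.map prod_list.Cons by (rule Polynomial.order_mult)
  also have "Polynomial.order x [:- y, 1:] = (if y = x then 1 else 0)"
    using order_power_n_n[of x 1] by (auto simp: order_0I)
  finally show ?case using Cons by simp
qed simp

text \<open>Root orders of the polynomial determine the multiset of eigenvalues, and a sorted list
  is determined by its multiset; hence the definite description is met by one list only.\<close>

lemma sorted_eigenvalues_eqI: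
  assumes "sorted xs" "char_poly A = (\<Prod>x\<leftarrow>xs. [:- complex_of_real x, 1:])"
  shows "sorted_eigenvalues A = xs"
  unfolding sorted_eigenvalues_def
proof (rule the_equality)
  fix ys assume ys: "sorted ys \<and> char_poly A = (\<Prod>x\<leftarrow>ys. [:- complex_of_real x, 1:])"
  have *: "Polynomial.order (complex_of_real x) (\<Prod>x\<leftarrow>zs. [:- complex_of_real x, 1:]) = count (mset zs) x"
    for x and zs :: "real list"
  proof -
    have "(\<Prod>x\<leftarrow>zs. [:- complex_of_real x, 1:]) = (\<Prod>y\<leftarrow>map complex_of_real zs. [:- y, 1:])"
      by (simp add: o_def)
    then have "Polynomial.order (complex_of_real x) (\<Prod>x\<leftarrow>zs. [:- complex_of_real x, 1:]) =
        count (mset (map complex_of_real zs)) (complex_of_real x)"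
      by (simp only: order_prod_linear)
    also have "\<dots> = count (mset zs) x"
      by (induction zs) auto
    finally show ?thesis .
  qed
  have "count (mset ys) x = count (mset xs) x" for x
    using *[of x ys] *[of x xs] ys assms(2) by simp
  then have "mset ys = mset xs" by (simp add: multiset_eq_iff)
  then show "ys = xs" using ys assms(1) by (metis properties_for_sort sorted_sort_id)
qed (use assms in auto)

section \<open>The lattice with pendant vertices\<close>

definition lattice_emb :: "int^'d::finite \<Rightarrow> real^'d" where
  "lattice_emb m = (\<chi> s. of_int (vec_nth m s))"

definition cell :: "(real^'d::finite) set" where
  "cell = {y. \<forall>s. 0 \<le> vec_nth y s \<and> vec_nth y s < 1}"

lemma lattice_emb_nth [simp]: "vec_nth (lattice_emb m) s = of_int (vec_nth m s)"
  by (simp add: lattice_emb_def)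

lemma lattice_emb_add: "lattice_emb (m + n) = lattice_emb m + lattice_emb n"
  and lattice_emb_diff: "lattice_emb (m - n) = lattice_emb m - lattice_emb n"
  and lattice_emb_0 [simp]: "lattice_emb 0 = 0"
  and lattice_emb_axis: "lattice_emb (axis s 1) = axis s 1"
  by (simp_all add: Finite_Cartesian_Product.vec_eq_iff axis_def)

text \<open>Two numbers in [0, 1) cannot differ by a nonzero integer. All later statements that
  vertices or edges are different rest on this uniqueness.\<close>

lemma lattice_emb_cell_eqD:
  assumes "lattice_emb m + y = lattice_emb n + z" "y \<in> cell" "z \<in> cell"
  shows "m = n" "y = z"
proof -
  have "vec_nth m s = vec_nth n s" for s
  proof -
    have "of_int (vec_nth m s) + vec_nth y s = of_int (vec_nth n s) + vec_nth z s"
      using arg_cong[OF assms(1), of "\<lambda>x. vec_nth x s"] by simp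
    moreover have "0 \<le> vec_nth y s" "vec_nth y s < 1" "0 \<le> vec_nth z s" "vec_nth z s < 1"
      using assms(2,3) by (auto simp: cell_def)
    ultimately show ?thesis by linarith
  qed
  then show "m = n" by (simp add: Finite_Cartesian_Product.vec_eq_iff)
  then show "y = z" using assms(1) by simp
qed

lemma zero_in_cell [simp]: "0 \<in> cell"
  by (simp add: cell_def)

lemma lattice_emb_inject [simp]: "lattice_emb m = lattice_emb n \<longleftrightarrow> m = n"
  using lattice_emb_cell_eqD(1)[of m 0 n 0] by auto

lemma image_case_prod_Times: "(\<lambda>(m, q). F m q) ` (UNIV \<times> S) = {F m q | m q. q \<in> S}"
  by auto

text \<open>The axes \<open>a\<close> and \<open>b\<close> span the plane of the pendant directions;
  two different axes are what d \<ge> 2 supplies.\<close>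

locale pendant_lattice =
  fixes a b :: "'d::finite" and \<nu> :: nat
  assumes ab: "a \<noteq> b" and nu: "\<nu> \<ge> 2"
begin

text \<open>
  The pendant vertices of the origin are \<open>pend j\<close> for \<open>1 \<le> j < \<nu>\<close>; their directions are pairwise
  different and not parallel to an axis, so the straight edges meet only at the origin.
  Index 0 stands for the lattice point itself.
\<close>

definition pend :: "nat \<Rightarrow> real^'d" where
  "pend j = (\<chi> s. if j = 0 then 0 else if s = a then 1 / 2
                  else if s = b then real j / (2 * real \<nu>) else 0)"

text \<open>Only the positive axis directions occur, so that each lattice edge arises from a single
  pair of base point and direction.\<close>

definition dirs :: "(real^'d) set" where
  "dirs = range (\<lambda>s. axis s 1) \<union> pend ` {1..<\<nu>}"

definition seg :: "int^'d \<Rightarrow> real^'d \<Rightarrow> (real^'d) set" where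
  "seg m q = closed_segment (lattice_emb m) (lattice_emb m + q)"

definition G :: "'d pgraph" where
  "G = \<lparr>verts = {lattice_emb m + pend j | m j. j < \<nu>}, edges = {seg m q | m q. q \<in> dirs},
        period = \<lambda>s. axis s 1\<rparr>"

lemma pend_0 [simp]: "pend 0 = 0"
  by (simp add: pend_def Finite_Cartesian_Product.vec_eq_iff)

lemma pend_nth_a: "j \<noteq> 0 \<Longrightarrow> vec_nth (pend j) a = 1 / 2"
  and pend_nth_b: "j \<noteq> 0 \<Longrightarrow> vec_nth (pend j) b = real j / (2 * real \<nu>)"
  using ab by (auto simp: pend_def)

section \<open>Geometry of the edge directions\<close>

lemma pend_bounds:
  assumes "j < \<nu>"
  shows "0 \<le> vec_nth (pend j) s" "vec_nth (pend j) s \<le> 1 / 2"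
  using assms by (auto simp: pend_def field_simps)

lemma pend_in_cell: "j < \<nu> \<Longrightarrow> pend j \<in> cell"
proof -
  assume "j < \<nu>"
  then have "0 \<le> vec_nth (pend j) s \<and> vec_nth (pend j) s < 1" for s
    using pend_bounds[of j s] by simp
  then show ?thesis by (simp add: cell_def)
qed

lemma pend_nonzero: "j \<noteq> 0 \<Longrightarrow> pend j \<noteq> 0"
  using pend_nth_a[of j] by auto

lemma pend_inj:
  assumes "pend i = pend j"
  shows "i = j"
proof (cases "i = 0 \<or> j = 0")
  case True
  then show ?thesis
    using assms pend_nonzero[of i] pend_nonzero[of j] by (cases "i = 0"; cases "j = 0") auto
next
  case False
  then have "real i / (2 * real \<nu>) = real j / (2 * real \<nu>)"
    using pend_nth_b[of i] pend_nth_b[of j] assms by (metis (no_types))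
  then show ?thesis using nu by simp
qed

lemma axis_not_pend: "j < \<nu> \<Longrightarrow> axis s 1 \<noteq> pend j"
proof
  assume "j < \<nu>" "axis s 1 = pend j"
  then have "vec_nth (axis s (1::real)) s \<le> 1 / 2" using pend_bounds(2)[of j s] by simp
  then show False by simp
qed

lemma axis_inject: "axis s (1::real) = axis t 1 \<longleftrightarrow> s = t"
  by (simp add: axis_eq_axis)

lemma dirsE:
  assumes "q \<in> dirs"
  obtains s where "q = axis s 1" | j where "q = pend j" "1 \<le> j" "j < \<nu>"
  using assms by (auto simp: dirs_def)

lemma dirs_bounds:
  assumes "q \<in> dirs"
  shows "0 \<le> vec_nth q s" "vec_nth q s \<le> 1"
proof -
  have "0 \<le> vec_nth q s \<and> vec_nth q s \<le> 1"
    using assms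
  proof (cases rule: dirsE)
    case (2 j)
    then show ?thesis using pend_bounds[of j s] by simp
  qed (simp add: axis_def)
  then show "0 \<le> vec_nth q s" "vec_nth q s \<le> 1" by auto
qed

lemma dirs_nonzero: "q \<in> dirs \<Longrightarrow> q \<noteq> 0"
  by (elim dirsE) (auto simp: pend_nonzero)

lemma finite_dirs: "finite dirs"
  by (simp add: dirs_def)

text \<open>An edge without its far end stays in the cell of its base point, so its points can be
  compared by uniqueness of integer and fractional parts.\<close>

lemma scaled_dir_in_cell:
  assumes "q \<in> dirs" "0 \<le> t" "t < 1"
  shows "t *\<^sub>R q \<in> cell"
proof -
  have "0 \<le> t * vec_nth q s \<and> t * vec_nth q s < 1" for s
  proof -
    have "t * vec_nth q s \<le> t * 1"
      by (intro mult_left_mono dirs_bounds assms)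
    then show ?thesis using assms dirs_bounds(1)[OF assms(1), of s] by simp
  qed
  then show ?thesis by (simp add: cell_def)
qed

text \<open>A pendant direction has nonzero coordinates at both \<open>a\<close> and
  \<open>b\<close>, an axis vector has only one nonzero coordinate.\<close>

lemma scaled_axis_not_pend:
  assumes "0 < t" "j \<noteq> 0"
  shows "t *\<^sub>R axis s 1 \<noteq> u *\<^sub>R pend j \<or> u = 0"
proof (rule ccontr)
  assume "\<not> ?thesis"
  then have e: "t *\<^sub>R axis s 1 = u *\<^sub>R pend j" and u: "u \<noteq> 0" by auto
  have "vec_nth (t *\<^sub>R axis s 1) a = u / 2" "vec_nth (t *\<^sub>R axis s 1) b = u * (real j / (2 * real \<nu>))"
    unfolding e using assms by (simp_all add: pend_nth_a pend_nth_b)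
  then have "s = a" "s = b" using u assms nu by (auto simp: axis_def split: if_splits)
  then show False using ab by simp
qed

lemma scaled_dir_not_pend:
  assumes "q \<in> dirs" "0 < t" "t < 1" "j < \<nu>"
  shows "t *\<^sub>R q \<noteq> pend j"
proof
  assume e: "t *\<^sub>R q = pend j"
  then have j: "j \<noteq> 0" using assms(2) dirs_nonzero[OF assms(1)] by (cases "j = 0") auto
  from assms(1) show False
  proof (cases rule: dirsE)
    case (1 s)
    then show False using scaled_axis_not_pend[of t j s 1] e assms j by simp
  next
    case (2 k)
    then have "t * (1 / 2) = 1 / 2"
      using arg_cong[OF e, of "\<lambda>x. vec_nth x a"] j by (simp add: pend_nth_a)
    then show False using assms by simp
  qed
qed

text \<open>Different directions span different rays from the origin; this keeps the edges at one
  lattice point apart.\<close>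

lemma scaled_dirs_eqD:
  assumes "q \<in> dirs" "r \<in> dirs" "0 < t" "t *\<^sub>R q = u *\<^sub>R r"
  shows "q = r"
proof -
  have u: "u \<noteq> 0" using assms(3,4) dirs_nonzero[OF assms(1)] by auto
  \<comment> \<open>All directions have nonnegative coordinates, which rules out opposite
    rays.\<close>
  have u0: "u > 0"
  proof (rule ccontr)
    assume "\<not> u > 0"
    then have "t * vec_nth q s \<le> 0" for s
      using arg_cong[OF assms(4), of "\<lambda>x. vec_nth x s"] dirs_bounds(1)[OF assms(2), of s]
      by (simp add: mult_nonpos_nonneg)
    then have "vec_nth q s \<le> 0" for s
      using assms(3) by (simp add: mult_le_0_iff not_less)
    then have "vec_nth q s = 0" for s
      using dirs_bounds(1)[OF assms(1), of s] by (intro antisym)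
    then have "q = 0" by (simp add: Finite_Cartesian_Product.vec_eq_iff)
    then show False using dirs_nonzero assms by blast
  qed
  from assms(1) show ?thesis
  proof (cases rule: dirsE)
    case q: (1 s)
    from assms(2) show ?thesis
    proof (cases rule: dirsE)
      case (1 s')
      have "t * (if s' = s then 1 else 0) = u"
        using arg_cong[OF assms(4), of "\<lambda>x. vec_nth x s'"] unfolding q 1 by (simp add: axis_def)
      then show ?thesis using u q 1 by (auto split: if_splits)
    next
      case (2 k)
      then show ?thesis using scaled_axis_not_pend[of t k s u] assms u q by auto
    qed
  next
    case q: (2 j)
    from assms(2) show ?thesis
    proof (cases rule: dirsE)
      case (1 s)
      then show ?thesis using scaled_axis_not_pend[of u j s t] assms u0 q by auto
    next
      case (2 k)
      \<comment> \<open>All pendant directions share the coordinate 1/2 at \<open>a\<close>, so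
        comparing it fixes the scale.\<close>
      have "t = u"
        using arg_cong[OF assms(4), of "\<lambda>x. vec_nth x a"] q 2 by (simp add: pend_nth_a)
      then show ?thesis using assms by simp
    qed
  qed
qed

section \<open>Vertices and edges: embedding, connectedness, local finiteness\<close>

lemma verts_G: "verts G = {lattice_emb m + pend j | m j. j < \<nu>}"
  and edges_G: "edges G = {seg m q | m q. q \<in> dirs}"
  and period_G: "period G = (\<lambda>s. axis s 1)"
  by (simp_all add: G_def)

lemma vertI: "j < \<nu> \<Longrightarrow> lattice_emb m + pend j \<in> verts G"
  by (auto simp: verts_G)

lemma lattice_emb_vert: "lattice_emb m \<in> verts G"
  using vertI[of 0 m] nu by simp

lemma dir_end_vert: "q \<in> dirs \<Longrightarrow> lattice_emb m + q \<in> verts G"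
  by (elim dirsE) (auto intro: vertI simp: lattice_emb_vert simp flip: lattice_emb_add lattice_emb_axis)

lemma segE:
  assumes "x \<in> seg m q"
  obtains t where "0 \<le> t" "t \<le> 1" "x = lattice_emb m + t *\<^sub>R q"
  using assms unfolding seg_def in_segment by (auto simp: algebra_simps)

lemma segI: "0 \<le> t \<Longrightarrow> t \<le> 1 \<Longrightarrow> lattice_emb m + t *\<^sub>R q \<in> seg m q"
  unfolding seg_def in_segment by (rule exI[of _ t]) (auto simp: algebra_simps)

lemma interior_not_vert:
  assumes "q \<in> dirs" "0 < t" "t < 1"
  shows "lattice_emb m + t *\<^sub>R q \<notin> verts G"
proof
  assume "lattice_emb m + t *\<^sub>R q \<in> verts G"
  then obtain n j where j: "j < \<nu>" and e: "lattice_emb m + t *\<^sub>R q = lattice_emb n + pend j"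
    by (auto simp: verts_G)
  have "t *\<^sub>R q \<in> cell" using assms by (intro scaled_dir_in_cell) auto
  from lattice_emb_cell_eqD(2)[OF e this pend_in_cell[OF j]] scaled_dir_not_pend[OF assms j]
  show False by simp
qed

lemma seg_verts:
  assumes "q \<in> dirs"
  shows "seg m q \<inter> verts G = {lattice_emb m, lattice_emb m + q}"
proof
  show "seg m q \<inter> verts G \<subseteq> {lattice_emb m, lattice_emb m + q}"
  proof
    fix x assume x: "x \<in> seg m q \<inter> verts G"
    then obtain t where t: "0 \<le> t" "t \<le> 1" "x = lattice_emb m + t *\<^sub>R q" by (auto elim: segE)
    have "\<not> (0 < t \<and> t < 1)" using x t(3) interior_not_vert[OF assms, of t m] by blast
    then have "t = 0 \<or> t = 1" using t by linarith
    then show "x \<in> {lattice_emb m, lattice_emb m + q}" using t by auto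
  qed
  show "{lattice_emb m, lattice_emb m + q} \<subseteq> seg m q \<inter> verts G"
    using lattice_emb_vert dir_end_vert[OF assms] segI[of 0 m q] segI[of 1 m q] by auto
qed

text \<open>Off the vertices both parameters lie strictly between 0 and 1, so the point is written
  in two ways as lattice vector plus cell vector; uniqueness reduces the claim to rays from the
  origin.\<close>

lemma seg_interE:
  assumes "x \<in> seg m q" "x \<in> seg n r" "x \<notin> verts G" "q \<in> dirs" "r \<in> dirs"
  shows "m = n \<and> q = r"
proof -
  obtain t where t: "0 \<le> t" "t \<le> 1" "x = lattice_emb m + t *\<^sub>R q" using assms(1) by (rule segE)
  obtain u where u: "0 \<le> u" "u \<le> 1" "x = lattice_emb n + u *\<^sub>R r" using assms(2) by (rule segE)
  have "t \<noteq> 0" "t \<noteq> 1"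
    using t(3) assms(3) lattice_emb_vert[of m] dir_end_vert[OF assms(4), of m] by auto
  moreover have "u \<noteq> 0" "u \<noteq> 1"
    using u(3) assms(3) lattice_emb_vert[of n] dir_end_vert[OF assms(5), of n] by auto
  ultimately have tu: "0 < t" "t < 1" "0 < u" "u < 1" using t u by auto
  have *: "lattice_emb m + t *\<^sub>R q = lattice_emb n + u *\<^sub>R r" using t u by simp
  have c: "t *\<^sub>R q \<in> cell" "u *\<^sub>R r \<in> cell"
    using assms tu by (auto intro!: scaled_dir_in_cell)
  have "m = n" "t *\<^sub>R q = u *\<^sub>R r"
    using lattice_emb_cell_eqD[OF * c] by auto
  then show ?thesis using scaled_dirs_eqD assms(4,5) tu by blast
qed

text \<open>The midpoint is a common point that is not a vertex.\<close>

lemma seg_inject: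
  assumes "seg m q = seg n r" "q \<in> dirs" "r \<in> dirs"
  shows "m = n" "q = r"
proof -
  have x: "lattice_emb m + (1/2) *\<^sub>R q \<in> seg m q" by (intro segI) auto
  have "lattice_emb m + (1/2) *\<^sub>R q \<notin> verts G" by (intro interior_not_vert assms) auto
  from seg_interE[OF x x[unfolded assms(1)] this assms(2,3)] show "m = n" "q = r" by auto
qed

lemma seg_translate: "(+) (lattice_emb n) ` seg m q = seg (n + m) q"
  by (simp add: seg_def closed_segment_translation lattice_emb_add add.assoc)

lemma verts_translate: "(+) (lattice_emb n) ` verts G = verts G"
proof -
  have "lattice_emb n + x \<in> verts G" if x: "x \<in> verts G" for n x
  proof -
    obtain m j where "j < \<nu>" "x = lattice_emb m + pend j" using x by (auto simp: verts_G)
    then show ?thesis using vertI[of j "n + m"] by (simp add: lattice_emb_add add.assoc)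
  qed
  note * = this
  have "x \<in> (+) (lattice_emb n) ` verts G" if "x \<in> verts G" for x
  proof (rule image_eqI)
    show "lattice_emb (- n) + x \<in> verts G" by (rule * [OF that])
    show "x = lattice_emb n + (lattice_emb (- n) + x)"
      by (simp add: add.assoc[symmetric] lattice_emb_add[symmetric])
  qed
  then show ?thesis using * by blast
qed

lemma edges_translate: "(\<lambda>e. (+) (lattice_emb n) ` e) ` edges G = edges G"
proof -
  have "seg m q \<in> (\<lambda>e. (+) (lattice_emb n) ` e) ` edges G" if "q \<in> dirs" for m q
    by (rule image_eqI[of _ _ "seg (m - n) q"]) (use that in \<open>auto simp: seg_translate edges_G\<close>)
  moreover have "(+) (lattice_emb n) ` seg m q \<in> edges G" if "q \<in> dirs" for m q
    using that unfolding seg_translate edges_G by blast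
  ultimately show ?thesis unfolding edges_G by blast
qed

lemma embedded_G: "embedded_in_space G"
  unfolding embedded_in_space_def
proof (intro conjI ballI impI)
  fix e assume "e \<in> edges G"
  then obtain m q where e: "e = seg m q" "q \<in> dirs" by (auto simp: edges_G)
  let ?g = "linepath (lattice_emb m) (lattice_emb m + q)"
  have "simple_path ?g" using dirs_nonzero[OF e(2)] by (intro simple_path_linepath) auto
  moreover have "path_image ?g = e" by (simp add: e seg_def)
  ultimately show "\<exists>g. simple_path g \<and> path_image g = e \<and> e \<inter> verts G = {pathstart g, pathfinish g}"
    using seg_verts[OF e(2)] by (intro exI[of _ ?g]) (auto simp: e(1))
next
  fix e e' assume "e \<in> edges G" "e' \<in> edges G" "e \<noteq> e'"
  then show "e \<inter> e' \<subseteq> verts G"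
    using seg_interE unfolding edges_G by blast
qed

text \<open>Induction on the l1 norm, which drops when a nonzero coordinate moves one step towards
  0.\<close>

lemma int_vec_induct:
  fixes P :: "int^'d \<Rightarrow> bool"
  assumes "P 0" "\<And>m s. P m \<Longrightarrow> P (m + axis s 1)" "\<And>m s. P m \<Longrightarrow> P (m - axis s 1)"
  shows "P m"
proof (induction "\<Sum>s\<in>UNIV. nat \<bar>vec_nth m s\<bar>" arbitrary: m rule: less_induct)
  case less
  show ?case
  proof (cases "m = 0")
    case False
    then obtain s where s: "vec_nth m s \<noteq> 0" by (auto simp: Finite_Cartesian_Product.vec_eq_iff)
    define n where "n = (if vec_nth m s > 0 then m - axis s 1 else m + axis s 1)"
    have "(\<Sum>u\<in>UNIV. nat \<bar>vec_nth n u\<bar>) < (\<Sum>u\<in>UNIV. nat \<bar>vec_nth m u\<bar>)"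
    proof (rule sum_strict_mono_ex1)
      show "\<forall>u\<in>UNIV. nat \<bar>vec_nth n u\<bar> \<le> nat \<bar>vec_nth m u\<bar>"
        using s by (auto simp: n_def axis_def)
      show "\<exists>u\<in>UNIV. nat \<bar>vec_nth n u\<bar> < nat \<bar>vec_nth m u\<bar>"
        using s by (intro bexI[of _ s]) (auto simp: n_def)
    qed simp
    then have "P n" by (rule less)
    moreover have "m = (if vec_nth m s > 0 then n + axis s 1 else n - axis s 1)" by (simp add: n_def)
    ultimately show ?thesis using assms by metis
  qed (simp add: assms)
qed

lemma connected_G: "connected_pgraph G"
proof -
  let ?R = "{(x, y). \<exists>e\<in>edges G. e \<inter> verts G = {x, y}}"
  have sym: "sym (?R\<^sup>*)"
    by (intro sym_rtrancl symI) (auto simp: insert_commute)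
  have R: "(lattice_emb m, lattice_emb m + q) \<in> ?R" if "q \<in> dirs" for m q
    using seg_verts[OF that] that by (auto simp: edges_G)
  have ax: "axis s 1 \<in> dirs" for s by (simp add: dirs_def)
  have lat: "(0, lattice_emb m) \<in> ?R\<^sup>*" for m
  proof (induction m rule: int_vec_induct)
    case (2 m s)
    have "(lattice_emb m, lattice_emb (m + axis s 1)) \<in> ?R"
      using R[OF ax, of m s] by (simp add: lattice_emb_add lattice_emb_axis)
    with 2 show ?case by (rule rtrancl_into_rtrancl)
  next
    case (3 m s)
    have "(lattice_emb (m - axis s 1), lattice_emb m) \<in> ?R"
      using R[OF ax, of "m - axis s 1" s] by (simp add: lattice_emb_diff lattice_emb_axis)
    from symD[OF sym r_into_rtrancl[OF this]]
    have "(lattice_emb m, lattice_emb (m - axis s 1)) \<in> ?R\<^sup>*" .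
    with 3 show ?case by (rule rtrancl_trans)
  qed simp
  have all: "(0, v) \<in> ?R\<^sup>*" if v: "v \<in> verts G" for v
  proof -
    obtain m j where v: "j < \<nu>" "v = lattice_emb m + pend j" using v by (auto simp: verts_G)
    show ?thesis
    proof (cases "j = 0")
      case True
      then show ?thesis using lat v by simp
    next
      case False
      then have "pend j \<in> dirs" using v(1) by (auto simp: dirs_def)
      from R[OF this, of m] show ?thesis unfolding v(2) by (rule rtrancl_into_rtrancl[OF lat])
    qed
  qed
  have "(u, v) \<in> ?R\<^sup>*" if "u \<in> verts G" "v \<in> verts G" for u v
    by (rule rtrancl_trans[OF symD[OF sym all[OF that(1)]] all[OF that(2)]])
  moreover have "verts G \<noteq> {}" using lattice_emb_vert[of 0] by auto
  ultimately show ?thesis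
    unfolding connected_pgraph_def by (intro conjI ballI)
qed

lemma finite_int_vec_box: "finite {m :: int^'d. \<forall>s. vec_nth m s \<in> {l..u}}"
proof -
  have "{m :: int^'d. \<forall>s. vec_nth m s \<in> {l..u}} \<subseteq> vec_lambda ` PiE UNIV (\<lambda>_. {l..u})"
    by (intro subsetI image_eqI[of _ vec_lambda "vec_nth _"]) (auto simp: vec_nth_inverse)
  then show ?thesis by (rule finite_subset) (intro finite_imageI finite_PiE, auto)
qed

lemma finite_verts_bounded:
  assumes "bounded B"
  shows "finite (verts G \<inter> B)"
proof -
  obtain K where K: "\<And>x. x \<in> B \<Longrightarrow> norm x \<le> K" using assms by (auto simp: bounded_iff)
  \<comment> \<open>The extra 1 on the left leaves room for the pendant offset, whose coordinates
    are at most 1/2.\<close>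
  let ?S = "{m :: int^'d. \<forall>s. vec_nth m s \<in> {- \<lceil>K\<rceil> - 1..\<lceil>K\<rceil>}}"
  have "verts G \<inter> B \<subseteq> (\<lambda>(m, j). lattice_emb m + pend j) ` (?S \<times> {..<\<nu>})"
  proof
    fix x assume x: "x \<in> verts G \<inter> B"
    then obtain m j where mj: "j < \<nu>" "x = lattice_emb m + pend j" by (auto simp: verts_G)
    have "vec_nth m s \<in> {- \<lceil>K\<rceil> - 1..\<lceil>K\<rceil>}" for s
    proof -
      have "\<bar>of_int (vec_nth m s) + vec_nth (pend j) s\<bar> \<le> K"
        using component_le_norm_cart[of x s] K[of x] x mj by auto
      then show ?thesis using pend_bounds[OF mj(1), of s] by auto linarith+
    qed
    then show "x \<in> (\<lambda>(m, j). lattice_emb m + pend j) ` (?S \<times> {..<\<nu>})" using mj by auto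
  qed
  then show ?thesis by (rule finite_subset) (intro finite_imageI finite_cartesian_product finite_int_vec_box, auto)
qed

lemma finite_edges_at:
  assumes "v \<in> verts G"
  shows "finite {e \<in> edges G. v \<in> e}"
proof -
  have "{e \<in> edges G. v \<in> e} \<subseteq>
    (\<Union>q\<in>dirs. (\<lambda>m. seg m q) ` ((lattice_emb -` {v}) \<union> (lattice_emb -` {v - q})))"
  proof
    fix e assume "e \<in> {e \<in> edges G. v \<in> e}"
    then obtain m q where e: "e = seg m q" "q \<in> dirs" "v \<in> seg m q" by (auto simp: edges_G)
    then have "v = lattice_emb m \<or> v = lattice_emb m + q" using seg_verts[OF e(2), of m] assms by auto
    then have "m \<in> (lattice_emb -` {v}) \<union> (lattice_emb -` {v - q})" by auto
    then show "e \<in> (\<Union>q\<in>dirs. (\<lambda>m. seg m q) ` ((lattice_emb -` {v}) \<union> (lattice_emb -` {v - q})))"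
      using e(1,2) by blast
  qed
  moreover have "finite (lattice_emb -` {w} :: (int^'d) set)" for w
    by (intro finite_vimageI injI) auto
  then have "finite (\<Union>q\<in>dirs. (\<lambda>m. seg m q) ` ((lattice_emb -` {v}) \<union> (lattice_emb -` {v - q})))"
    using finite_dirs by (intro finite_UN_I finite_imageI finite_UnI) auto
  ultimately show ?thesis by (rule finite_subset)
qed

lemma range_axis_Basis: "range (\<lambda>s. axis s (1::real)) = (Basis :: (real^'d) set)"
  by (auto simp: Basis_vec_def)

lemma periodic_G: "periodic_graph G"
proof -
  have "(+) (axis s 1) ` verts G = verts G" "(\<lambda>e. (+) (axis s 1) ` e) ` edges G = edges G" for s
    using verts_translate[of "axis s 1"] edges_translate[of "axis s 1"] by (simp_all add: lattice_emb_axis)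
  then show ?thesis
    unfolding periodic_graph_def period_G range_axis_Basis
    using embedded_G connected_G finite_verts_bounded finite_edges_at
    by (intro conjI allI impI ballI independent_Basis span_Basis injI) (simp_all add: axis_inject)
qed

section \<open>Oriented edges\<close>

definition fwd :: "int^'d \<Rightarrow> real^'d \<Rightarrow> 'd oedge" where
  "fwd m q = (seg m q, lattice_emb m, lattice_emb m + q, False)"

definition bwd :: "int^'d \<Rightarrow> real^'d \<Rightarrow> 'd oedge" where
  "bwd m q = (seg m q, lattice_emb m + q, lattice_emb m, False)"

lemma init_fwd [simp]: "init (fwd m q) = lattice_emb m"
  and ter_fwd [simp]: "ter (fwd m q) = lattice_emb m + q"
  and init_bwd [simp]: "init (bwd m q) = lattice_emb m + q"
  and ter_bwd [simp]: "ter (bwd m q) = lattice_emb m"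
  by (simp_all add: fwd_def bwd_def init_def ter_def)

text \<open>Directions are nonzero, so the graph itself has no loops and the tag is always
  \<open>False\<close>; each edge has just its two traversals.\<close>

lemma oriented_edges_G:
  "oriented_edges G = {fwd m q | m q. q \<in> dirs} \<union> {bwd m q | m q. q \<in> dirs}"
proof (intro equalityI subsetI)
  fix A assume A: "A \<in> oriented_edges G"
  obtain e u v t where A_eq: "A = (e, u, v, t)" by (cases A)
  obtain m q where e: "e = seg m q" "q \<in> dirs"
    using A by (auto simp: A_eq oriented_edges_def edges_G)
  have uv: "{u, v} = {lattice_emb m, lattice_emb m + q}" and t: "t \<longrightarrow> u = v"
    using A seg_verts[OF e(2), of m] by (auto simp: A_eq oriented_edges_def e(1))
  have "lattice_emb m \<noteq> lattice_emb m + q" using dirs_nonzero[OF e(2)] by simp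
  then have "\<not> t" using uv t by (metis doubleton_eq_iff)
  from uv have "u = lattice_emb m \<and> v = lattice_emb m + q \<or> u = lattice_emb m + q \<and> v = lattice_emb m"
    by (simp add: doubleton_eq_iff)
  then have "A = fwd m q \<or> A = bwd m q"
    using \<open>\<not> t\<close> by (auto simp: A_eq fwd_def bwd_def e(1))
  then show "A \<in> {fwd m q | m q. q \<in> dirs} \<union> {bwd m q | m q. q \<in> dirs}"
    using e(2) by blast
next
  have "fwd m q \<in> oriented_edges G" "bwd m q \<in> oriented_edges G" if "q \<in> dirs" for m q
    using seg_verts[OF that, of m] that
    by (auto simp: fwd_def bwd_def oriented_edges_def edges_G)
  then show "A \<in> {fwd m q | m q. q \<in> dirs} \<union> {bwd m q | m q. q \<in> dirs} \<Longrightarrow> A \<in> oriented_edges G" for A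
    by blast
qed

lemma axis_in_dirs: "axis s 1 \<in> dirs"
  and pend_in_dirs: "1 \<le> j \<Longrightarrow> j < \<nu> \<Longrightarrow> pend j \<in> dirs"
  by (auto simp: dirs_def)

lemma fwd_oriented: "q \<in> dirs \<Longrightarrow> fwd m q \<in> oriented_edges G"
  and bwd_oriented: "q \<in> dirs \<Longrightarrow> bwd m q \<in> oriented_edges G"
  unfolding oriented_edges_G by blast+

lemma fwd_inject:
  assumes "fwd m q = fwd n r"
  shows "m = n" "q = r"
  using assms by (auto simp: fwd_def)

lemma bwd_inject:
  assumes "bwd m q = bwd n r"
  shows "m = n" "q = r"
  using assms by (auto simp: bwd_def)

lemma fwd_not_bwd:
  assumes "q \<in> dirs" "r \<in> dirs"
  shows "fwd m q \<noteq> bwd n r"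
proof
  assume "fwd m q = bwd n r"
  then have "seg m q = seg n r" "lattice_emb m = lattice_emb n + r" by (auto simp: fwd_def bwd_def)
  then show False using seg_inject(1)[OF _ assms, of m n] dirs_nonzero[OF assms(2)] by auto
qed

definition out :: "real^'d \<Rightarrow> 'd oedge set" where
  "out v = {A \<in> oriented_edges G. init A = v}"

lemma pend_vert_eqD:
  assumes "lattice_emb m + pend i = lattice_emb n + pend j" "i < \<nu>" "j < \<nu>"
  shows "m = n" "i = j"
proof -
  note * = lattice_emb_cell_eqD[OF assms(1) pend_in_cell[OF assms(2)] pend_in_cell[OF assms(3)]]
  show "m = n" by (rule *(1))
  show "i = j" using *(2) by (rule pend_inj)
qed

text \<open>Besides the edges based at \<open>m\<close>, only axis edges based at a neighbour end
  here: a pendant edge ends at a pendant vertex, never at a lattice point.\<close>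

lemma out_hub:
  "out (lattice_emb m) = fwd m ` dirs \<union> (\<lambda>s. bwd (m - axis s 1) (axis s 1)) ` UNIV"
proof (intro equalityI subsetI)
  fix A assume "A \<in> out (lattice_emb m)"
  then consider q where "A = fwd m q" "q \<in> dirs"
    | n q where "A = bwd n q" "q \<in> dirs" "lattice_emb n + q = lattice_emb m"
    by (auto simp: out_def oriented_edges_G)
  then show "A \<in> fwd m ` dirs \<union> (\<lambda>s. bwd (m - axis s 1) (axis s 1)) ` UNIV"
  proof cases
    case (2 n q)
    from 2(2) show ?thesis
    proof (cases rule: dirsE)
      case (1 s)
      then have "lattice_emb (n + axis s 1) = lattice_emb m"
        using 2(3) by (simp add: lattice_emb_add lattice_emb_axis)
      then have "n = m - axis s 1" by auto
      then show ?thesis using 2 1 by auto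
    next
      case q: (2 j)
      then show ?thesis using pend_vert_eqD(2)[of n j m 0] 2(3) nu by simp
    qed
  qed auto
next
  fix A assume "A \<in> fwd m ` dirs \<union> (\<lambda>s. bwd (m - axis s 1) (axis s 1)) ` UNIV"
  then show "A \<in> out (lattice_emb m)"
    by (auto simp: out_def fwd_oriented bwd_oriented axis_in_dirs lattice_emb_diff lattice_emb_axis)
qed

lemma out_pend:
  assumes "1 \<le> j" "j < \<nu>"
  shows "out (lattice_emb m + pend j) = {bwd m (pend j)}"
proof (intro equalityI subsetI)
  fix A assume "A \<in> out (lattice_emb m + pend j)"
  then consider n q where "A = fwd n q" "q \<in> dirs" "lattice_emb n = lattice_emb m + pend j"
    | n q where "A = bwd n q" "q \<in> dirs" "lattice_emb n + q = lattice_emb m + pend j"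
    by (auto simp: out_def oriented_edges_G)
  then show "A \<in> {bwd m (pend j)}"
  proof cases
    case (1 n q)
    then show ?thesis using pend_vert_eqD(2)[of n 0 m j] assms by simp
  next
    case (2 n q)
    from 2(2) show ?thesis
    proof (cases rule: dirsE)
      case (1 s)
      then have "lattice_emb (n + axis s 1) + pend 0 = lattice_emb m + pend j"
        using 2(3) by (simp add: lattice_emb_add lattice_emb_axis)
      then show ?thesis using pend_vert_eqD(2)[of "n + axis s 1" 0 m j] assms by simp
    next
      case q: (2 k)
      then show ?thesis using pend_vert_eqD[of n k m j] 2 assms by simp
    qed
  qed
next
  show "A \<in> {bwd m (pend j)} \<Longrightarrow> A \<in> out (lattice_emb m + pend j)" for A
    using assms by (auto simp: out_def bwd_oriented pend_in_dirs)
qed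

text \<open>With a general summand this gives both the Laplacian and the degree at a lattice
  point.\<close>

lemma sum_out_hub:
  fixes F :: "'d oedge \<Rightarrow> 'b::comm_monoid_add"
  shows "sum F (out (lattice_emb m)) =
    (\<Sum>s\<in>UNIV. F (fwd m (axis s 1)) + F (bwd (m - axis s 1) (axis s 1)))
      + (\<Sum>j\<in>{1..<\<nu>}. F (fwd m (pend j)))"
proof -
  let ?B = "(\<lambda>s. bwd (m - axis s 1) (axis s 1)) ` UNIV"
  have "fwd m ` dirs \<inter> ?B = {}"
    using fwd_not_bwd[OF _ axis_in_dirs] by blast
  then have "sum F (out (lattice_emb m)) = sum F (fwd m ` dirs) + sum F ?B"
    unfolding out_hub using finite_dirs by (intro sum.union_disjoint) auto
  also have "sum F ?B = (\<Sum>s\<in>UNIV. F (bwd (m - axis s 1) (axis s 1)))"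
    by (subst sum.reindex) (auto simp: inj_def axis_inject dest!: bwd_inject(2))
  also have "sum F (fwd m ` dirs) = (\<Sum>q\<in>dirs. F (fwd m q))"
    by (subst sum.reindex) (auto simp: inj_on_def dest: fwd_inject(2))
  also have "\<dots> = (\<Sum>q\<in>range (\<lambda>s. axis s 1). F (fwd m q)) + (\<Sum>q\<in>pend ` {1..<\<nu>}. F (fwd m q))"
    unfolding dirs_def using axis_not_pend by (intro sum.union_disjoint) auto
  also have "(\<Sum>q\<in>range (\<lambda>s. axis s 1). F (fwd m q)) = (\<Sum>s\<in>UNIV. F (fwd m (axis s 1)))"
    by (subst sum.reindex) (auto simp: inj_def axis_inject)
  also have "(\<Sum>q\<in>pend ` {1..<\<nu>}. F (fwd m q)) = (\<Sum>j\<in>{1..<\<nu>}. F (fwd m (pend j)))"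
    by (subst sum.reindex) (auto simp: inj_on_def dest: pend_inj)
  finally show ?thesis by (simp add: sum.distrib add_ac)
qed

lemma sum_out_pend:
  assumes "1 \<le> j" "j < \<nu>"
  shows "sum F (out (lattice_emb m + pend j)) = F (bwd m (pend j))"
  by (simp add: out_pend[OF assms])

section \<open>The fundamental cell\<close>

lemma lattice_vector_G: "lattice_vector G m = lattice_emb m"
  and unit_cell_G: "unit_cell G = cell"
proof -
  have *: "(\<Sum>s\<in>UNIV. t s *\<^sub>R axis s 1) = (\<chi> s. t s)" for t :: "'d \<Rightarrow> real"
    by (simp add: Finite_Cartesian_Product.vec_eq_iff axis_def if_distrib cong: if_cong)
  show "lattice_vector G m = lattice_emb m"
    by (simp add: lattice_vector_def period_G * lattice_emb_def)
  show "unit_cell G = cell"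
    unfolding unit_cell_def period_G * cell_def
    by (auto intro: exI[of _ "vec_nth _"])
qed

lemma int_part_G: "y \<in> cell \<Longrightarrow> int_part G (lattice_emb m + y) = m"
  unfolding int_part_def lattice_vector_G unit_cell_G
proof (rule the_equality)
  fix n assume y: "y \<in> cell" and n: "lattice_emb m + y - lattice_emb n \<in> cell"
  show "n = m"
    using lattice_emb_cell_eqD(1)[of n "lattice_emb m + y - lattice_emb n" m y] y n by simp
qed simp

lemma cell_part_G: "y \<in> cell \<Longrightarrow> cell_part G (lattice_emb m + y) = y"
  by (simp add: cell_part_def int_part_G lattice_vector_G)

lemma fund_verts_G: "fund_verts G = pend ` {..<\<nu>}"
proof (intro equalityI subsetI)
  fix v assume "v \<in> fund_verts G"
  then obtain m j where mj: "j < \<nu>" "v = lattice_emb m + pend j" and v: "v \<in> cell"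
    by (auto simp: fund_verts_def unit_cell_G verts_G)
  then have "v = pend j"
    using lattice_emb_cell_eqD(2)[of m "pend j" 0 v] pend_in_cell by simp
  then show "v \<in> pend ` {..<\<nu>}" using mj by simp
next
  fix v assume "v \<in> pend ` {..<\<nu>}"
  then show "v \<in> fund_verts G"
    using vertI[of _ 0] pend_in_cell by (auto simp: fund_verts_def unit_cell_G)
qed

lemma card_fund_verts_G: "card (fund_verts G) = \<nu>"
  unfolding fund_verts_G by (subst card_image) (auto simp: inj_on_def dest: pend_inj)

text \<open>A function on the vertices becomes \<nu> functions on Z^d, with layer 0 on the lattice
  points. In this form the Laplacian is a \<nu> by \<nu> block operator in which \<open>adj\<close>
  occurs only in the corner (0, 0).\<close>

definition layer :: "(real^'d \<Rightarrow> complex) \<Rightarrow> nat \<Rightarrow> int^'d \<Rightarrow> complex" where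
  "layer f j m = f (lattice_emb m + pend j)"

lemma layer_laplacian_hub:
  "layer (laplacian G f) 0 m = of_nat (2 * CARD('d) + (\<nu> - 1)) * layer f 0 m
     - adj (layer f 0) m - (\<Sum>j\<in>{1..<\<nu>}. layer f j m)"
proof -
  have "layer (laplacian G f) 0 m = (\<Sum>A\<in>out (lattice_emb m). f (lattice_emb m) - f (ter A))"
    by (simp add: layer_def laplacian_def out_def lattice_emb_vert)
  also have "\<dots> = of_nat (2 * CARD('d) + (\<nu> - 1)) * layer f 0 m
     - adj (layer f 0) m - (\<Sum>j\<in>{1..<\<nu>}. layer f j m)"
    using nu unfolding sum_out_hub adj_def
    by (simp add: layer_def sum_subtractf sum.distrib algebra_simps lattice_emb_add lattice_emb_diff
        lattice_emb_axis)
  finally show ?thesis .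
qed

lemma layer_laplacian_pend:
  assumes "1 \<le> j" "j < \<nu>"
  shows "layer (laplacian G f) j m = layer f j m - layer f 0 m"
proof -
  have "layer (laplacian G f) j m =
      (\<Sum>A\<in>out (lattice_emb m + pend j). f (lattice_emb m + pend j) - f (ter A))"
    using assms by (simp add: layer_def laplacian_def out_def vertI)
  then show ?thesis by (simp add: sum_out_pend[OF assms] layer_def)
qed

lemma degree_hub: "degree_at G (lattice_emb m) = 2 * CARD('d) + (\<nu> - 1)"
proof -
  have "degree_at G (lattice_emb m) = (\<Sum>A\<in>out (lattice_emb m). 1)"
    by (simp add: degree_at_def out_def)
  also have "\<dots> = 2 * CARD('d) + (\<nu> - 1)" unfolding sum_out_hub by simp
  finally show ?thesis .
qed

lemma degree_pend:
  assumes "1 \<le> j" "j < \<nu>"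
  shows "degree_at G (lattice_emb m + pend j) = 1"
  using out_pend[OF assms, of m] by (simp add: degree_at_def out_def)

subsection \<open>The spectrum\<close>

lemma lessThan_nu: "{..<\<nu>} = insert 0 {1..<\<nu>}"
  using nu by auto

text \<open>The vertex set is the disjoint union of \<nu> translates of the lattice, so
  \<open>l2 G\<close> is an orthogonal sum of \<nu> sequence spaces over Z^d.\<close>

lemma l2_iff: "f \<in> l2 G \<longleftrightarrow> (\<forall>v. v \<notin> verts G \<longrightarrow> f v = 0) \<and> (\<forall>j<\<nu>. sq_summable (layer f j))" (is ?iff)
  and l2_norm_power2: "f \<in> l2 G \<Longrightarrow> (l2_norm G f)\<^sup>2 = (\<Sum>j<\<nu>. (sq_norm (layer f j))\<^sup>2)"
proof -
  define B where "B j = range (\<lambda>m. lattice_emb m + pend j)" for j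
  let ?F = "\<lambda>v. (cmod (f v))\<^sup>2"
  have V: "verts G = (\<Union>j\<in>{..<\<nu>}. B j)" by (auto simp: verts_G B_def)
  have disj: "B i \<inter> B j = {}" if "i \<in> {..<\<nu>}" "j \<in> {..<\<nu>}" "i \<noteq> j" for i j
    using that by (auto simp: B_def dest: pend_vert_eqD(2))
  have inj: "inj (\<lambda>m. lattice_emb m + pend j)" for j by (auto simp: inj_def)
  have sB: "?F summable_on B j \<longleftrightarrow> sq_summable (layer f j)" for j
    unfolding B_def sq_summable_def layer_def by (subst summable_on_reindex[OF inj]) (simp add: o_def)
  have iB: "infsum ?F (B j) = (sq_norm (layer f j))\<^sup>2" for j
    unfolding B_def sq_norm_power2 layer_def by (subst infsum_reindex[OF inj]) (simp add: o_def)
  have "?F summable_on verts G \<longleftrightarrow> (\<forall>j<\<nu>. sq_summable (layer f j))"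
  proof
    assume "?F summable_on verts G"
    then have "?F summable_on B j" if "j < \<nu>" for j
      using summable_on_subset_banach[of ?F "verts G" "B j"] that unfolding V by blast
    then show "\<forall>j<\<nu>. sq_summable (layer f j)" using sB by simp
  next
    assume "\<forall>j<\<nu>. sq_summable (layer f j)"
    then show "?F summable_on verts G"
      unfolding V by (intro summable_on_finite_union_disjoint disj) (auto simp: sB)
  qed
  then show iff: ?iff by (auto simp: l2_def)
  assume "f \<in> l2 G"
  then have s: "\<forall>j<\<nu>. sq_summable (layer f j)" using iff by simp
  have "(l2_norm G f)\<^sup>2 = infsum ?F (verts G)"
    unfolding l2_norm_def by (intro real_sqrt_pow2 infsum_nonneg) auto
  also have "\<dots> = (\<Sum>j<\<nu>. infsum ?F (B j))"
    unfolding V by (rule sum_infsum[symmetric]) (use s disj sB in auto)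
  finally show "(l2_norm G f)\<^sup>2 = (\<Sum>j<\<nu>. (sq_norm (layer f j))\<^sup>2)" by (simp add: iB)
qed

lemma l2_norm_nonneg: "0 \<le> l2_norm G f"
  unfolding l2_norm_def by (intro real_sqrt_ge_zero infsum_nonneg) auto

lemma l2_norm_eq_L2_set: "f \<in> l2 G \<Longrightarrow> l2_norm G f = L2_set (\<lambda>j. sq_norm (layer f j)) {..<\<nu>}"
  unfolding L2_set_def using l2_norm_power2[of f] l2_norm_nonneg[of f]
  by (metis real_sqrt_abs abs_of_nonneg)

lemma sq_norm_layer_le: "f \<in> l2 G \<Longrightarrow> j < \<nu> \<Longrightarrow> sq_norm (layer f j) \<le> l2_norm G f"
  unfolding l2_norm_eq_L2_set by (intro member_le_L2_set) auto

lemma l2_norm_le_sum: "f \<in> l2 G \<Longrightarrow> l2_norm G f \<le> (\<Sum>j<\<nu>. sq_norm (layer f j))"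
  by (simp add: l2_norm_eq_L2_set L2_set_le_sum)

lemma sq_summable_layer: "f \<in> l2 G \<Longrightarrow> j < \<nu> \<Longrightarrow> sq_summable (layer f j)"
  by (simp add: l2_iff)

lemma layer_ext:
  assumes "\<And>v. v \<notin> verts G \<Longrightarrow> f v = 0" "\<And>v. v \<notin> verts G \<Longrightarrow> g v = 0"
    "\<And>j m. j < \<nu> \<Longrightarrow> layer f j m = layer g j m"
  shows "f = g"
proof
  fix v
  show "f v = g v"
  proof (cases "v \<in> verts G")
    case True
    then obtain m j where "j < \<nu>" "v = lattice_emb m + pend j" by (auto simp: verts_G)
    then show ?thesis using assms(3)[of j m] by (simp add: layer_def)
  qed (simp add: assms)
qed

lemma ex_layer:
  assumes "\<And>j. j < \<nu> \<Longrightarrow> sq_summable (F j)"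
  obtains f where "f \<in> l2 G" "\<And>j. j < \<nu> \<Longrightarrow> layer f j = F j"
proof -
  let ?\<phi> = "\<lambda>(m, j). lattice_emb m + pend j" and ?S = "(UNIV :: (int^'d) set) \<times> {..<\<nu>}"
  define f where "f v = (if v \<in> verts G then case inv_into ?S ?\<phi> v of (m, j) \<Rightarrow> F j m else 0)" for v
  have inj: "inj_on ?\<phi> ?S" by (auto simp: inj_on_def dest: pend_vert_eqD)
  have c: "layer f j = F j" if "j < \<nu>" for j
  proof
    fix m
    have "inv_into ?S ?\<phi> (lattice_emb m + pend j) = (m, j)"
      using inv_into_f_f[OF inj, of "(m, j)"] that by simp
    then show "layer f j m = F j m" using that by (simp add: layer_def f_def vertI)
  qed
  moreover have "f \<in> l2 G" unfolding l2_iff using c assms by (auto simp: f_def)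
  ultimately show ?thesis by (intro that)
qed

definition shifted :: "complex \<Rightarrow> (real^'d \<Rightarrow> complex) \<Rightarrow> real^'d \<Rightarrow> complex" where
  "shifted z f v = laplacian G f v - z * f v"

lemma layer_shifted_hub:
  "layer (shifted z f) 0 m = (of_nat (2 * CARD('d) + (\<nu> - 1)) - z) * layer f 0 m
     - adj (layer f 0) m - (\<Sum>j\<in>{1..<\<nu>}. layer f j m)"
proof -
  have "layer (shifted z f) 0 m = layer (laplacian G f) 0 m - z * layer f 0 m"
    by (simp add: layer_def shifted_def)
  then show ?thesis by (simp add: layer_laplacian_hub left_diff_distrib)
qed

lemma layer_shifted_pend:
  assumes "1 \<le> j" "j < \<nu>"
  shows "layer (shifted z f) j m = (1 - z) * layer f j m - layer f 0 m"
proof -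
  have "layer (shifted z f) j m = layer (laplacian G f) j m - z * layer f j m"
    by (simp add: layer_def shifted_def)
  then show ?thesis using layer_laplacian_pend[OF assms] by (simp add: left_diff_distrib)
qed

lemma shifted_l2:
  assumes "f \<in> l2 G"
  shows "shifted z f \<in> l2 G"
  unfolding l2_iff
proof (intro conjI allI impI)
  show "shifted z f v = 0" if "v \<notin> verts G" for v
    using assms that by (simp add: shifted_def laplacian_def l2_iff)
  fix j assume j: "j < \<nu>"
  have s: "sq_summable (layer f i)" if "i < \<nu>" for i using assms that by (simp add: l2_iff)
  show "sq_summable (layer (shifted z f) j)"
  proof (cases "j = 0")
    case True
    have "sq_summable (\<lambda>m. (of_nat (2 * CARD('d) + (\<nu> - 1)) - z) * layer f 0 m
       - adj (layer f 0) m - (\<Sum>j\<in>{1..<\<nu>}. layer f j m))"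
      by (intro sq_summable_diff sq_summable_cmult sq_summable_adj sq_summable_sum s) (use nu in auto)
    then show ?thesis unfolding True layer_shifted_hub[abs_def] .
  next
    case False
    have "sq_summable (\<lambda>m. (1 - z) * layer f j m - layer f 0 m)"
      by (intro sq_summable_diff sq_summable_cmult s j) (use nu in auto)
    moreover have "layer (shifted z f) j = (\<lambda>m. (1 - z) * layer f j m - layer f 0 m)"
      using False j by (intro ext layer_shifted_pend) auto
    ultimately show ?thesis by simp
  qed
qed

lemma in_spectrum_iff:
  "z \<in> laplacian_spectrum G \<longleftrightarrow>
    \<not> (bij_betw (shifted z) (l2 G) (l2 G) \<and> (\<exists>C. \<forall>f\<in>l2 G. l2_norm G f \<le> C * l2_norm G (shifted z f)))"
proof -
  have "(\<lambda>f v. laplacian G f v - z * f v) = shifted z"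
    "(\<lambda>v. laplacian G f v - z * f v) = shifted z f" for f
    by (simp_all add: shifted_def fun_eq_iff)
  then show ?thesis unfolding laplacian_spectrum_def by simp
qed

text \<open>The lower bound, applied to the difference of two functions with equal image, yields
  injectivity; together with surjectivity this makes the map a bijection.\<close>

lemma not_in_spectrumI:
  assumes bound: "\<And>f. f \<in> l2 G \<Longrightarrow> l2_norm G f \<le> C * l2_norm G (shifted z f)"
    and surj: "\<And>h. h \<in> l2 G \<Longrightarrow> \<exists>f\<in>l2 G. shifted z f = h"
  shows "z \<notin> laplacian_spectrum G"
proof -
  have "inj_on (shifted z) (l2 G)"
  proof (rule inj_onI)
    fix f g assume fg: "f \<in> l2 G" "g \<in> l2 G" "shifted z f = shifted z g"
    define d where "d v = f v - g v" for v
    have cd: "layer d j = (\<lambda>m. layer f j m - layer g j m)" for j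
      by (simp add: fun_eq_iff layer_def d_def)
    have d: "d \<in> l2 G"
      unfolding l2_iff cd using fg by (auto simp: l2_iff d_def sq_summable_diff)
    have "shifted z d v = shifted z f v - shifted z g v" for v
      unfolding shifted_def laplacian_def d_def by (simp add: algebra_simps sum.distrib sum_subtractf)
    then have "shifted z d = (\<lambda>v. 0)" using fg(3) by (simp add: fun_eq_iff)
    moreover have "l2_norm G (\<lambda>v. 0) = 0" by (simp add: l2_norm_def)
    ultimately have "l2_norm G d \<le> 0" using bound[OF d] by simp
    then have "sq_norm (layer d j) \<le> 0" if "j < \<nu>" for j
      using sq_norm_layer_le[OF d that] by simp
    then have "layer d j m = 0" if "j < \<nu>" for j m
      using cmod_le_sq_norm[OF sq_summable_layer[OF d that], of m] that
      by (metis norm_le_zero_iff order_trans)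
    then show "f = g"
      using fg(1,2) by (intro layer_ext) (auto simp: l2_iff cd)
  qed
  moreover have "shifted z ` l2 G = l2 G"
    using shifted_l2 surj by blast
  ultimately show ?thesis
    unfolding in_spectrum_iff bij_betw_def using bound by blast
qed

text \<open>
  Eliminating the pendant vertices turns \<open>\<Delta> - z\<close> into \<open>schur z - A\<close>, with \<open>A\<close> the adjacency
  operator of the lattice.
\<close>

definition schur :: "complex \<Rightarrow> complex" where
  "schur z = of_nat (2 * CARD('d) + (\<nu> - 1)) - z - of_nat (\<nu> - 1) / (1 - z)"

text \<open>Block Gaussian elimination: the pendant rows, divided by \<open>1 - z\<close> and added
  to the hub row, cancel the pendant layers there.\<close>

lemma layer_shifted_schur:
  assumes "z \<noteq> 1"
  shows "adj (layer f 0) m - schur z * layer f 0 m =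
    - (layer (shifted z f) 0 m + (\<Sum>j\<in>{1..<\<nu>}. 1 / (1 - z) * layer (shifted z f) j m))"
proof -
  have "(\<Sum>j\<in>{1..<\<nu>}. 1 / (1 - z) * layer (shifted z f) j m) =
      (\<Sum>j\<in>{1..<\<nu>}. layer f j m - 1 / (1 - z) * layer f 0 m)"
    using assms by (intro sum.cong) (auto simp: layer_shifted_pend field_simps)
  also have "\<dots> = (\<Sum>j\<in>{1..<\<nu>}. layer f j m) - of_nat (\<nu> - 1) / (1 - z) * layer f 0 m"
    by (simp add: sum_subtractf)
  finally show ?thesis
    unfolding layer_shifted_hub schur_def by (simp only: left_diff_distrib) simp
qed

text \<open>The resolvent of the adjacency operator controls the hub layer, and each pendant layer
  is recovered as (h_j + f_0) / (1 - z), where h is the image of f.\<close>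

lemma not_in_spectrum_schur:
  assumes z: "z \<noteq> 1"
    and \<mu>: "schur z \<notin> complex_of_real ` {- 2 * real CARD('d) .. 2 * real CARD('d)}"
  shows "z \<notin> laplacian_spectrum G"
proof -
  let ?c = "1 / (1 - z)"
  obtain C where C: "0 \<le> C"
    and bound: "\<And>f :: int^'d \<Rightarrow> complex. sq_summable f \<Longrightarrow> sq_norm f \<le> C * sq_norm (\<lambda>x. adj f x - schur z * f x)"
    and surj: "\<And>h :: int^'d \<Rightarrow> complex. sq_summable h \<Longrightarrow> \<exists>f. sq_summable f \<and> (\<forall>x. adj f x - schur z * f x = h x)"
    using adj_resolvent[OF \<mu>] by blast
  \<comment> \<open>Bounds the hub layer: the reduced right-hand side consists of the hub row and of
    \<nu> - 1 pendant rows scaled by \<open>1 / (1 - z)\<close>.\<close>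
  define C1 where "C1 = C * (1 + (\<Sum>j\<in>{1..<\<nu>}. cmod ?c))"
  show ?thesis
  proof (rule not_in_spectrumI[where C = "C1 + (\<Sum>j\<in>{1..<\<nu>}. cmod ?c * (1 + C1))"])
    fix f assume f: "f \<in> l2 G"
    define h where "h = shifted z f"
    define N where "N = l2_norm G h"
    have h: "h \<in> l2 G" unfolding h_def by (rule shifted_l2[OF f])
    have hN: "sq_norm (layer h j) \<le> N" "sq_summable (layer h j)" if "j < \<nu>" for j
      using sq_norm_layer_le[OF h that] sq_summable_layer[OF h that] by (simp_all add: N_def)
    have s0: "sq_summable (layer f 0)" using f nu by (simp add: l2_iff)
    let ?S = "\<lambda>m. \<Sum>j\<in>{1..<\<nu>}. ?c * layer h j m"
    have S: "sq_summable ?S" "sq_norm ?S \<le> (\<Sum>j\<in>{1..<\<nu>}. cmod ?c * N)"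
    proof -
      show "sq_summable ?S" using hN by (intro sq_summable_sum sq_summable_cmult) auto
      have "sq_norm ?S \<le> (\<Sum>j\<in>{1..<\<nu>}. sq_norm (\<lambda>m. ?c * layer h j m))"
        using hN by (intro sq_summable_sum sq_summable_cmult) auto
      also have "\<dots> \<le> (\<Sum>j\<in>{1..<\<nu>}. cmod ?c * N)"
        unfolding sq_norm_cmult using hN by (intro sum_mono mult_left_mono) auto
      finally show "sq_norm ?S \<le> (\<Sum>j\<in>{1..<\<nu>}. cmod ?c * N)" .
    qed
    have "sq_norm (layer f 0) \<le> C * sq_norm (\<lambda>m. - (layer h 0 m + ?S m))"
      using bound[OF s0] unfolding layer_shifted_schur[OF z] h_def .
    also have "\<dots> \<le> C * (N + (\<Sum>j\<in>{1..<\<nu>}. cmod ?c * N))"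
    proof (rule mult_left_mono[OF _ C])
      have "sq_norm (\<lambda>m. layer h 0 m + ?S m) \<le> sq_norm (layer h 0) + sq_norm ?S"
        using hN(2)[of 0] nu by (intro sq_summable_add S) auto
      then show "sq_norm (\<lambda>m. - (layer h 0 m + ?S m)) \<le> N + (\<Sum>j\<in>{1..<\<nu>}. cmod ?c * N)"
        unfolding sq_norm_uminus using S(2) hN(1)[of 0] nu by linarith
    qed
    also have "\<dots> = C1 * N" by (simp add: C1_def algebra_simps)
    finally have f0: "sq_norm (layer f 0) \<le> C1 * N" .
    have fj: "sq_norm (layer f j) \<le> cmod ?c * (1 + C1) * N" if j: "j \<in> {1..<\<nu>}" for j
    proof -
      have "layer f j = (\<lambda>m. ?c * (layer h j m + layer f 0 m))"
        using j z by (simp add: fun_eq_iff h_def layer_shifted_pend)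
      then have "sq_norm (layer f j) = cmod ?c * sq_norm (\<lambda>m. layer h j m + layer f 0 m)"
        by (simp only: sq_norm_cmult)
      also have "\<dots> \<le> cmod ?c * (N + C1 * N)"
        using sq_summable_add(2)[OF hN(2) s0, of j] hN(1)[of j] f0 j by (intro mult_left_mono) auto
      finally show ?thesis by (simp add: algebra_simps)
    qed
    have "l2_norm G f \<le> sq_norm (layer f 0) + (\<Sum>j\<in>{1..<\<nu>}. sq_norm (layer f j))"
      using l2_norm_le_sum[OF f] by (simp add: lessThan_nu)
    also have "\<dots> \<le> C1 * N + (\<Sum>j\<in>{1..<\<nu>}. cmod ?c * (1 + C1) * N)"
      by (intro add_mono f0 sum_mono fj)
    finally show "l2_norm G f \<le> (C1 + (\<Sum>j\<in>{1..<\<nu>}. cmod ?c * (1 + C1))) * l2_norm G (shifted z f)"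
      by (simp add: N_def h_def algebra_simps)
  next
    fix h assume h: "h \<in> l2 G"
    have hs: "sq_summable (layer h j)" if "j < \<nu>" for j using h that by (simp add: l2_iff)
    let ?H = "\<lambda>m. - (layer h 0 m + (\<Sum>j\<in>{1..<\<nu>}. ?c * layer h j m))"
    have "sq_summable ?H"
      using nu by (intro sq_summable_uminus sq_summable_add sq_summable_sum sq_summable_cmult hs) auto
    then obtain g where g: "sq_summable g" "\<And>m. adj g m - schur z * g m = ?H m"
      using surj by blast
    \<comment> \<open>Back substitution: these pendant layers solve the pendant rows
      exactly.\<close>
    define F where "F j = (if j = 0 then g else (\<lambda>m. ?c * (layer h j m + g m)))" for j :: nat
    have "sq_summable (F j)" if "j < \<nu>" for j
      unfolding F_def using sq_summable_cmult[OF sq_summable_add(1)[OF hs[OF that] g(1)], of ?c] g(1)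
      by (simp only: if_split) blast
    then obtain f where f: "f \<in> l2 G" "\<And>j. j < \<nu> \<Longrightarrow> layer f j = F j" using ex_layer by blast
    have f0: "layer f 0 = g" using f(2)[of 0] nu by (simp add: F_def)
    have fj: "layer (shifted z f) j m = layer h j m" if "j \<in> {1..<\<nu>}" for j m
      using that z f(2)[of j] by (simp add: layer_shifted_pend f0) (simp add: F_def)
    have "layer (shifted z f) 0 m = layer h 0 m" for m
    proof -
      have "adj (layer f 0) m - schur z * layer f 0 m = ?H m" unfolding f0 by (rule g)
      moreover have "(\<Sum>j\<in>{1..<\<nu>}. ?c * layer (shifted z f) j m) = (\<Sum>j\<in>{1..<\<nu>}. ?c * layer h j m)"
        using fj by (intro sum.cong) auto
      ultimately show ?thesis unfolding layer_shifted_schur[OF z] by simp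
    qed
    then have "layer (shifted z f) j m = layer h j m" if "j < \<nu>" for j m
      using fj[of j m] that by (cases "j = 0") auto
    moreover have "shifted z f v = 0" "h v = 0" if "v \<notin> verts G" for v
      using shifted_l2[OF f(1), of z] h that unfolding l2_iff by blast+
    ultimately have "shifted z f = h" by (intro layer_ext)
    then show "\<exists>f\<in>l2 G. shifted z f = h" using f by blast
  qed
qed

text \<open>An approximate eigenfunction g of the adjacency operator is lifted with pendant layers g
  / (1 - z). All pendant rows then vanish, the residual is that of g, and a bounded inverse is
  impossible.\<close>

lemma in_spectrum_schur:
  assumes z: "z \<noteq> 1"
    and \<mu>: "schur z \<in> complex_of_real ` {- 2 * real CARD('d) .. 2 * real CARD('d)}"
  shows "z \<in> laplacian_spectrum G"
proof (rule ccontr)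
  let ?c = "1 / (1 - z)"
  assume "z \<notin> laplacian_spectrum G"
  then obtain C where C: "\<And>f. f \<in> l2 G \<Longrightarrow> l2_norm G f \<le> C * l2_norm G (shifted z f)"
    unfolding in_spectrum_iff by blast
  obtain \<mu> where \<mu>: "\<mu> \<in> {- 2 * real CARD('d) .. 2 * real CARD('d)}" "schur z = of_real \<mu>"
    using \<mu> by blast
  obtain g :: "int^'d \<Rightarrow> complex" where g: "sq_summable g"
    "C * sq_norm (\<lambda>x. adj g x - schur z * g x) < sq_norm g"
    using adj_not_bounded_below[OF \<mu>(1), of C] unfolding \<mu>(2) by blast
  define F where "F j = (if j = 0 then g else (\<lambda>m. ?c * g m))" for j :: nat
  have "sq_summable (F j)" if "j < \<nu>" for j
    unfolding F_def using sq_summable_cmult[OF g(1), of ?c] g(1) by (simp only: if_split) blast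
  then obtain f where f: "f \<in> l2 G" "\<And>j. j < \<nu> \<Longrightarrow> layer f j = F j" using ex_layer by blast
  have f0: "layer f 0 = g" using f(2)[of 0] nu by (simp add: F_def)
  have fj: "layer (shifted z f) j = (\<lambda>m. 0)" if "j \<in> {1..<\<nu>}" for j
    using that z f(2)[of j] by (simp add: layer_shifted_pend f0 fun_eq_iff) (simp add: F_def)
  have "adj g m - schur z * g m = - layer (shifted z f) 0 m" for m
    using layer_shifted_schur[OF z, of f m] fj by (simp add: f0)
  then have e: "sq_norm (\<lambda>m. adj g m - schur z * g m) = sq_norm (layer (shifted z f) 0)"
    by (simp add: sq_norm_uminus)
  have "l2_norm G (shifted z f) = L2_set (\<lambda>j. sq_norm (layer (shifted z f) j)) (insert 0 {1..<\<nu>})"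
    using l2_norm_eq_L2_set[OF shifted_l2[OF f(1), of z]] by (simp only: lessThan_nu)
  also have "\<dots> = sq_norm (layer (shifted z f) 0)"
    using fj by (subst L2_set_insert) (auto simp: L2_set_0')
  finally have "l2_norm G f \<le> C * sq_norm (\<lambda>m. adj g m - schur z * g m)"
    using C[OF f(1)] e by simp
  then show False using g(2) sq_norm_layer_le[OF f(1), of 0] nu f0 by simp
qed

text \<open>The values 1 and -1 on two pendant vertices of the origin cancel at the lattice point
  and give an eigenfunction; two such vertices exist because \<nu> \<ge> 3.\<close>

lemma one_in_spectrum:
  assumes "\<nu> \<ge> 3"
  shows "1 \<in> laplacian_spectrum G"
proof -
  define F where "F j m = (if m = 0 then if j = 1 then 1 else if j = 2 then - 1 else 0 else 0 :: complex)"
    for j :: nat and m :: "int^'d"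
  have "sq_summable (F j)" for j
  proof (rule sq_summableI_bounded)
    fix A :: "(int^'d) set" assume "finite A"
    have "L2_set (\<lambda>m. cmod (F j m)) A \<le> (\<Sum>m\<in>A. cmod (F j m))" by (intro L2_set_le_sum) auto
    also have "\<dots> \<le> (\<Sum>m\<in>A. if m = 0 then 1 else 0)" by (intro sum_mono) (simp add: F_def)
    also have "\<dots> \<le> 1" using \<open>finite A\<close> by simp
    finally show "L2_set (\<lambda>m. cmod (F j m)) A \<le> 1" .
  qed
  then obtain f where f: "f \<in> l2 G" "\<And>j. j < \<nu> \<Longrightarrow> layer f j = F j" using ex_layer by blast
  have f0: "layer f 0 = (\<lambda>m. 0)" using f(2)[of 0] nu by (simp add: F_def fun_eq_iff)
  have "(\<Sum>j\<in>{1..<\<nu>}. layer f j m) = (\<Sum>j\<in>{1, 2}. F j m)" for m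
    using assms f(2) by (intro sum.mono_neutral_cong_right) (auto simp: F_def)
  then have "layer (shifted 1 f) 0 m = 0" for m
    unfolding layer_shifted_hub f0 by (simp add: adj_def F_def)
  moreover have "layer (shifted 1 f) j m = 0" if "1 \<le> j" "j < \<nu>" for j m
    using that by (simp add: layer_shifted_pend f0)
  ultimately have "layer (shifted 1 f) j m = layer (\<lambda>v. 0) j m" if "j < \<nu>" for j m
    using that by (cases "j = 0") (auto simp: layer_def)
  moreover have "shifted 1 f v = 0" if "v \<notin> verts G" for v
    using shifted_l2[OF f(1), of 1] that unfolding l2_iff by blast
  ultimately have "shifted 1 f = (\<lambda>v. 0)" by (intro layer_ext) auto
  moreover have "shifted 1 (\<lambda>v. 0) = (\<lambda>v. 0)"
    by (simp add: shifted_def laplacian_def fun_eq_iff)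
  moreover have "(\<lambda>v. 0) \<in> l2 G" by (simp add: l2_def)
  moreover have "f \<noteq> (\<lambda>v. 0)"
  proof
    assume "f = (\<lambda>v. 0)"
    then have "layer f 1 0 = 0" by (simp add: layer_def)
    then show False using f(2)[of 1] nu by (simp add: F_def)
  qed
  ultimately have "\<not> inj_on (shifted 1) (l2 G)"
    using f(1) unfolding inj_on_def by metis
  then show "1 \<in> laplacian_spectrum G" unfolding in_spectrum_iff bij_betw_def by blast
qed

text \<open>With h = (Delta - 1) f, the only pendant row reads h_1 = - f_0, and the hub row then
  gives f_1 = 2 d f_0 - A f_0 - h_0. The inverse is explicit and bounded although
  \<open>schur\<close> has a pole.\<close>

lemma one_not_in_spectrum:
  assumes "\<nu> = 2"
  shows "1 \<notin> laplacian_spectrum G"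
proof (rule not_in_spectrumI)
  let ?D = "of_nat (2 * CARD('d)) :: complex"
  have set1: "{1..<\<nu>} = {1}" using assms by auto
  have hub: "layer (shifted 1 f) 0 m = ?D * layer f 0 m - adj (layer f 0) m - layer f 1 m" for f m
    unfolding layer_shifted_hub set1 using assms by simp
  have pend1: "layer (shifted 1 f) 1 m = - layer f 0 m" for f m
    using layer_shifted_pend[of 1 1 f m] nu by simp
  {
    fix f assume f: "f \<in> l2 G"
    define h where "h = shifted 1 f"
    define N where "N = l2_norm G h"
    have h: "h \<in> l2 G" unfolding h_def by (rule shifted_l2[OF f])
    have hN: "sq_norm (layer h j) \<le> N" "sq_summable (layer h j)" if "j < 2" for j
      using sq_norm_layer_le[OF h] sq_summable_layer[OF h] that assms by (simp_all add: N_def)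
    have "layer f 0 = (\<lambda>m. - layer h 1 m)" unfolding h_def pend1 by simp
    then have f0: "sq_norm (layer f 0) \<le> N" using hN(1)[of 1] by (simp add: sq_norm_uminus)
    have s0: "sq_summable (layer f 0)" using f nu by (simp add: l2_iff)
    have "layer f 1 = (\<lambda>m. (?D * layer f 0 m - adj (layer f 0) m) - layer h 0 m)"
      by (simp add: hub h_def fun_eq_iff)
    then have "sq_norm (layer f 1) \<le> (cmod ?D * sq_norm (layer f 0) + sq_norm (adj (layer f 0))) + sq_norm (layer h 0)"
      using sq_summable_diff[OF sq_summable_diff(1)[OF sq_summable_cmult[OF s0] sq_summable_adj(1)[OF s0]] hN(2)[of 0], of ?D]
        sq_summable_diff(2)[OF sq_summable_cmult[OF s0] sq_summable_adj(1)[OF s0], of ?D]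
      by (simp add: sq_norm_cmult)
    also have "\<dots> \<le> (cmod ?D * N + 2 * real CARD('d) * N) + N"
      using order_trans[OF sq_summable_adj(2)[OF s0] mult_left_mono[OF f0, of "2 * real CARD('d)"]] hN(1)[of 0] f0
      by (intro add_mono mult_left_mono) auto
    finally have f1: "sq_norm (layer f 1) \<le> (cmod ?D + 2 * real CARD('d) + 1) * N"
      by (simp add: algebra_simps)
    have "l2_norm G f \<le> sq_norm (layer f 0) + sq_norm (layer f 1)"
      using l2_norm_le_sum[OF f] unfolding lessThan_nu set1 by simp
    also have "\<dots> \<le> N + (cmod ?D + 2 * real CARD('d) + 1) * N" by (intro add_mono f0 f1)
    finally show "l2_norm G f \<le> (1 + (cmod ?D + 2 * real CARD('d) + 1)) * l2_norm G (shifted 1 f)"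
      by (simp add: N_def h_def algebra_simps)
  }
  {
    fix h assume h: "h \<in> l2 G"
    have hs: "sq_summable (layer h j)" if "j < \<nu>" for j using h that by (simp add: l2_iff)
    define g where "g m = - layer h 1 m" for m
    have g: "sq_summable g" unfolding g_def using hs[of 1] assms by (simp add: sq_summable_uminus)
    define F where "F j = (if j = 0 then g else (\<lambda>m. ?D * g m - adj g m - layer h 0 m))" for j :: nat
    have "sq_summable (F j)" if "j < \<nu>" for j
      using g hs[of 0] nu by (auto simp: F_def intro!: sq_summable_diff sq_summable_cmult sq_summable_adj)
    then obtain f where f: "f \<in> l2 G" "\<And>j. j < \<nu> \<Longrightarrow> layer f j = F j" using ex_layer by blast
    have "layer f 0 = g" "layer f 1 = (\<lambda>m. ?D * g m - adj g m - layer h 0 m)"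
      using f(2)[of 0] f(2)[of 1] assms by (simp_all add: F_def)
    then have "layer (shifted 1 f) 0 m = layer h 0 m" "layer (shifted 1 f) 1 m = layer h 1 m" for m
      unfolding hub pend1 by (simp_all add: g_def)
    moreover have "j = 0 \<or> j = 1" if "j < \<nu>" for j using that assms by auto
    ultimately have "shifted 1 f = h"
      using shifted_l2[OF f(1), of 1] h by (intro layer_ext) (auto simp: l2_iff)
    then show "\<exists>f\<in>l2 G. shifted 1 f = h" using f by blast
  }
qed

subsection \<open>The Floquet matrices\<close>

lemma shift_fwd: "shift_oedge (lattice_emb k) (fwd m q) = fwd (k + m) q"
  and shift_bwd: "shift_oedge (lattice_emb k) (bwd m q) = bwd (k + m) q"
  by (simp_all add: shift_oedge_def fwd_def bwd_def seg_translate lattice_emb_add add.assoc)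

text \<open>An axis direction becomes a loop in the quotient; its two orientations stay apart as a
  forward and a backward class.\<close>

definition fwd_class :: "real^'d \<Rightarrow> 'd oedge set" where
  "fwd_class q = range (\<lambda>n. fwd n q)"

definition bwd_class :: "real^'d \<Rightarrow> 'd oedge set" where
  "bwd_class q = range (\<lambda>n. bwd n q)"

lemma fund_oriented_edges_G:
  "fund_oriented_edges G = fwd_class ` dirs \<union> bwd_class ` dirs"
proof -
  let ?R = "{(a, a'). a \<in> oriented_edges G \<and> a' \<in> oriented_edges G \<and>
               (\<exists>m. a' = shift_oedge (lattice_vector G m) a)}"
  have f: "?R `` {fwd m q} = fwd_class q" if q: "q \<in> dirs" for m q
  proof (intro equalityI subsetI)
    fix A assume "A \<in> ?R `` {fwd m q}"
    then obtain k where "A = shift_oedge (lattice_emb k) (fwd m q)" by (auto simp: lattice_vector_G)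
    then show "A \<in> fwd_class q" by (simp add: shift_fwd fwd_class_def)
  next
    fix A assume "A \<in> fwd_class q"
    then obtain n where A: "A = fwd n q" by (auto simp: fwd_class_def)
    then have "A = shift_oedge (lattice_vector G (n - m)) (fwd m q)"
      by (simp add: lattice_vector_G shift_fwd)
    moreover have "fwd m q \<in> oriented_edges G" "A \<in> oriented_edges G"
      unfolding A by (rule fwd_oriented[OF q])+
    ultimately show "A \<in> ?R `` {fwd m q}" by (intro ImageI[of "fwd m q"]) auto
  qed
  have b: "?R `` {bwd m q} = bwd_class q" if q: "q \<in> dirs" for m q
  proof (intro equalityI subsetI)
    fix A assume "A \<in> ?R `` {bwd m q}"
    then obtain k where "A = shift_oedge (lattice_emb k) (bwd m q)" by (auto simp: lattice_vector_G)
    then show "A \<in> bwd_class q" by (simp add: shift_bwd bwd_class_def)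
  next
    fix A assume "A \<in> bwd_class q"
    then obtain n where A: "A = bwd n q" by (auto simp: bwd_class_def)
    then have "A = shift_oedge (lattice_vector G (n - m)) (bwd m q)"
      by (simp add: lattice_vector_G shift_bwd)
    moreover have "bwd m q \<in> oriented_edges G" "A \<in> oriented_edges G"
      unfolding A by (rule bwd_oriented[OF q])+
    ultimately show "A \<in> ?R `` {bwd m q}" by (intro ImageI[of "bwd m q"]) auto
  qed
  have "fund_oriented_edges G = (\<lambda>A. ?R `` {A}) ` oriented_edges G"
    unfolding fund_oriented_edges_def quotient_def by auto
  also have "\<dots> = (\<lambda>A. ?R `` {A}) ` ((\<lambda>(m, q). fwd m q) ` (UNIV \<times> dirs) \<union> (\<lambda>(m, q). bwd m q) ` (UNIV \<times> dirs))"
    by (simp only: oriented_edges_G image_case_prod_Times)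
  also have "\<dots> = (\<lambda>(m, q). ?R `` {fwd m q}) ` (UNIV \<times> dirs) \<union> (\<lambda>(m, q). ?R `` {bwd m q}) ` (UNIV \<times> dirs)"
    by (simp only: image_Un image_image case_prod_unfold)
  also have "(\<lambda>(m, q). ?R `` {fwd m q}) ` (UNIV \<times> dirs) = fwd_class ` dirs"
  proof -
    have "(\<lambda>(m, q). ?R `` {fwd m q}) ` (UNIV \<times> dirs) = (\<lambda>(m :: int^'d, q). fwd_class q) ` (UNIV \<times> dirs)"
      using f by (intro image_cong) auto
    then show ?thesis by force
  qed
  also have "(\<lambda>(m, q). ?R `` {bwd m q}) ` (UNIV \<times> dirs) = bwd_class ` dirs"
  proof -
    have "(\<lambda>(m, q). ?R `` {bwd m q}) ` (UNIV \<times> dirs) = (\<lambda>(m :: int^'d, q). bwd_class q) ` (UNIV \<times> dirs)"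
      using b by (intro image_cong) auto
    then show ?thesis by force
  qed
  finally show ?thesis .
qed

lemma sum_fund_oriented_edges:
  fixes g :: "'d oedge set \<Rightarrow> complex"
  shows "(\<Sum>c | c \<in> fund_oriented_edges G \<and> P c. g c) =
    (\<Sum>s\<in>UNIV. (if P (fwd_class (axis s 1)) then g (fwd_class (axis s 1)) else 0)
      + (if P (bwd_class (axis s 1)) then g (bwd_class (axis s 1)) else 0))
    + (\<Sum>j\<in>{1..<\<nu>}. (if P (fwd_class (pend j)) then g (fwd_class (pend j)) else 0)
      + (if P (bwd_class (pend j)) then g (bwd_class (pend j)) else 0))"
proof -
  let ?g = "\<lambda>c. if P c then g c else 0"
  have fin: "finite (fund_oriented_edges G)" by (simp add: fund_oriented_edges_G finite_dirs)
  have dirs: "sum h dirs = (\<Sum>s\<in>UNIV. h (axis s 1)) + (\<Sum>j\<in>{1..<\<nu>}. h (pend j))" for h :: "_ \<Rightarrow> complex"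
  proof -
    have "sum h dirs = sum h (range (\<lambda>s. axis s 1)) + sum h (pend ` {1..<\<nu>})"
      unfolding dirs_def using axis_not_pend by (intro sum.union_disjoint) auto
    also have "sum h (range (\<lambda>s. axis s 1)) = (\<Sum>s\<in>UNIV. h (axis s 1))"
      by (subst sum.reindex) (auto simp: inj_def axis_inject)
    also have "sum h (pend ` {1..<\<nu>}) = (\<Sum>j\<in>{1..<\<nu>}. h (pend j))"
      by (subst sum.reindex) (auto simp: inj_on_def dest: pend_inj)
    finally show ?thesis .
  qed
  have disj: "fwd_class ` dirs \<inter> bwd_class ` dirs = {}"
  proof -
    have "fwd_class q \<noteq> bwd_class r" if "q \<in> dirs" "r \<in> dirs" for q r
    proof
      assume "fwd_class q = bwd_class r"
      then have "fwd 0 q \<in> bwd_class r" unfolding fwd_class_def by blast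
      then show False using fwd_not_bwd[OF that] by (auto simp: bwd_class_def)
    qed
    then show ?thesis by blast
  qed
  have injf: "inj_on fwd_class dirs"
  proof (rule inj_onI)
    fix q r assume "fwd_class q = fwd_class r"
    then have "fwd 0 q \<in> fwd_class r" unfolding fwd_class_def by blast
    then show "q = r" by (auto simp: fwd_class_def dest: fwd_inject(2))
  qed
  have injb: "inj_on bwd_class dirs"
  proof (rule inj_onI)
    fix q r assume "bwd_class q = bwd_class r"
    then have "bwd 0 q \<in> bwd_class r" unfolding bwd_class_def by blast
    then show "q = r" by (auto simp: bwd_class_def dest: bwd_inject(2))
  qed
  have "(\<Sum>c | c \<in> fund_oriented_edges G \<and> P c. g c) = sum ?g (fund_oriented_edges G)"
    using sum.inter_filter[OF fin, of g P] by simp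
  also have "\<dots> = sum ?g (fwd_class ` dirs) + sum ?g (bwd_class ` dirs)"
    unfolding fund_oriented_edges_G using disj finite_dirs by (intro sum.union_disjoint) auto
  also have "\<dots> = (\<Sum>q\<in>dirs. ?g (fwd_class q)) + (\<Sum>q\<in>dirs. ?g (bwd_class q))"
    by (simp only: sum.reindex[OF injf] sum.reindex[OF injb] o_def)
  finally show ?thesis unfolding dirs by (simp only: sum.distrib add_ac)
qed

lemma the_elem_range_const: "(\<And>n. f n = x) \<Longrightarrow> the_elem (range f) = x"
proof -
  assume "\<And>n. f n = x"
  then have "range f = {x}" by auto
  then show ?thesis by simp
qed

text \<open>Splitting \<open>q\<close> into integer and cell part treats both kinds of edges at
  once: \<open>y = 0\<close> for axis directions, \<open>k = 0\<close> for pendant ones.\<close>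

lemma fwd_bwd_class_data:
  assumes "q = lattice_emb k + y" "y \<in> cell"
  shows "fund_init G (fwd_class q) = 0" "fund_ter G (fwd_class q) = y" "fund_index G (fwd_class q) = k"
    "fund_init G (bwd_class q) = y" "fund_ter G (bwd_class q) = 0" "fund_index G (bwd_class q) = - k"
proof -
  have q: "lattice_emb n + q = lattice_emb (n + k) + y" for n
    by (simp add: assms(1) lattice_emb_add)
  have c: "cell_part G (lattice_emb n + q) = y" "int_part G (lattice_emb n + q) = n + k"
    "cell_part G (lattice_emb n) = 0" "int_part G (lattice_emb n) = n" for n
    using cell_part_G[OF assms(2), of "n + k"] int_part_G[OF assms(2), of "n + k"]
      cell_part_G[OF zero_in_cell, of n] int_part_G[OF zero_in_cell, of n]
    unfolding q by simp_all
  show "fund_init G (fwd_class q) = 0" "fund_ter G (fwd_class q) = y" "fund_index G (fwd_class q) = k"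
    "fund_init G (bwd_class q) = y" "fund_ter G (bwd_class q) = 0" "fund_index G (bwd_class q) = - k"
    unfolding fund_init_def fund_ter_def fund_index_def fwd_class_def bwd_class_def image_image
    by (intro the_elem_range_const; simp add: c edge_index_def)+
qed

lemma axis_class_data:
  "fund_init G (fwd_class (axis s 1)) = 0" "fund_ter G (fwd_class (axis s 1)) = 0"
  "fund_index G (fwd_class (axis s 1)) = axis s 1"
  "fund_init G (bwd_class (axis s 1)) = 0" "fund_ter G (bwd_class (axis s 1)) = 0"
  "fund_index G (bwd_class (axis s 1)) = - axis s 1"
  by (rule fwd_bwd_class_data[of _ "axis s 1" 0]; simp add: lattice_emb_axis)+

lemma pend_class_data:
  assumes "j < \<nu>"
  shows "fund_init G (fwd_class (pend j)) = 0" "fund_ter G (fwd_class (pend j)) = pend j"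
    "fund_index G (fwd_class (pend j)) = 0"
    "fund_init G (bwd_class (pend j)) = pend j" "fund_ter G (bwd_class (pend j)) = 0"
    "fund_index G (bwd_class (pend j)) = 0"
proof -
  note * = fwd_bwd_class_data[of "pend j" 0 "pend j", OF _ pend_in_cell[OF assms]]
  show "fund_init G (fwd_class (pend j)) = 0" "fund_ter G (fwd_class (pend j)) = pend j"
    "fund_index G (fwd_class (pend j)) = 0"
    "fund_init G (bwd_class (pend j)) = pend j" "fund_ter G (bwd_class (pend j)) = 0"
    "fund_index G (bwd_class (pend j)) = 0"
    using * by simp_all
qed

definition energy :: "real^'d \<Rightarrow> real" where
  "energy \<theta> = (\<Sum>s\<in>UNIV. 2 - 2 * cos (vec_nth \<theta> s))"

text \<open>At the hub, the loops subtract the sum of 2 cos \<theta>_s from the degree 2 d + \<nu> -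
  1, leaving E + \<nu> - 1. Pendant edges have index 0 and contribute the constant entries -1. The
  hub position comes from the enumeration and is the same for all \<theta>.\<close>

lemma floquet_matrix_G:
  obtains h where "h < \<nu>"
    "\<And>\<theta>. floquet_matrix G \<theta> = arrow_mat \<nu> h (of_real (energy \<theta>) + of_nat (\<nu> - 1))"
proof -
  let ?h = "fund_vertex G"
  have "\<exists>h. bij_betw h {..<card (fund_verts G)} (fund_verts G)"
    using ex_bij_betw_nat_finite[of "fund_verts G"] fund_verts_G by (simp add: lessThan_atLeast0)
  then have bij: "bij_betw ?h {..<\<nu>} (pend ` {..<\<nu>})"
    unfolding fund_vertex_def using someI_ex by (metis (no_types, lifting) card_fund_verts_G fund_verts_G)
  have "pend 0 \<in> pend ` {..<\<nu>}" using nu by (intro imageI) auto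
  then obtain h where h: "h < \<nu>" "?h h = 0"
    using bij unfolding bij_betw_def by (metis imageE lessThan_iff pend_0)
  have inj: "?h i = ?h k \<longleftrightarrow> i = k" if "i < \<nu>" "k < \<nu>" for i k
    using bij that unfolding bij_betw_def inj_on_def by blast
  have hub: "?h i = 0 \<longleftrightarrow> i = h" if "i < \<nu>" for i
    using inj[OF that h(1)] h(2) by simp
  have pd: "\<exists>j. 1 \<le> j \<and> j < \<nu> \<and> ?h i = pend j" if "i < \<nu>" "i \<noteq> h" for i
  proof -
    have "?h i \<in> pend ` {..<\<nu>}" using bij_betwE[OF bij] that(1) by simp
    then obtain j where j: "?h i = pend j" "j < \<nu>" by auto
    then have "j \<noteq> 0" using hub[OF that(1)] that(2) by (cases "j = 0") auto
    then show ?thesis using j by (intro exI[of _ j]) auto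
  qed
  have deg: "degree_at G (?h i) = (if i = h then 2 * CARD('d) + (\<nu> - 1) else 1)" if "i < \<nu>" for i
  proof (cases "i = h")
    case True
    then show ?thesis using degree_hub[of 0] h by simp
  next
    case False
    from pd[OF that False] obtain j where "1 \<le> j" "j < \<nu>" "?h i = pend j" by (elim exE conjE)
    then show ?thesis using degree_pend[of j 0] False by simp
  qed
  show ?thesis
  proof (rule that[OF h(1)])
    fix \<theta> :: "real^'d"
    let ?e = "\<lambda>c. exp (\<i> * of_real (\<Sum>s\<in>UNIV. of_int (vec_nth (fund_index G c) s) * vec_nth \<theta> s))"
    let ?P = "\<lambda>i k c. fund_init G c = ?h i \<and> fund_ter G c = ?h k"
    have e_axis: "?e (fwd_class (axis s 1)) + ?e (bwd_class (axis s 1)) = of_real (2 * cos (vec_nth \<theta> s))" for s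
    proof -
      have "(\<Sum>u\<in>UNIV. real_of_int (vec_nth (axis s 1) u) * vec_nth \<theta> u) = (\<Sum>u\<in>UNIV. if u = s then vec_nth \<theta> s else 0)"
        by (intro sum.cong) (auto simp: axis_def)
      then have "(\<Sum>u\<in>UNIV. real_of_int (vec_nth (axis s 1) u) * vec_nth \<theta> u) = vec_nth \<theta> s" by simp
      then show ?thesis
        by (simp add: axis_class_data sum_negf) (simp add: complex_eq_iff Re_exp Im_exp)
    qed
    have S: "(\<Sum>c | c \<in> fund_oriented_edges G \<and> ?P i k c. ?e c) =
       (if i = h \<and> k = h then \<Sum>s\<in>UNIV. of_real (2 * cos (vec_nth \<theta> s)) else 0)
       + (if i = h \<and> k \<noteq> h then 1 else 0) + (if i \<noteq> h \<and> k = h then 1 else 0)"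
      if i: "i < \<nu>" and k: "k < \<nu>" for i k
    proof -
      have ax: "(\<Sum>s\<in>UNIV. (if ?P i k (fwd_class (axis s 1)) then ?e (fwd_class (axis s 1)) else 0)
        + (if ?P i k (bwd_class (axis s 1)) then ?e (bwd_class (axis s 1)) else 0)) =
        (if i = h \<and> k = h then \<Sum>s\<in>UNIV. of_real (2 * cos (vec_nth \<theta> s)) else 0)"
      proof -
        have P: "?P i k (fwd_class (axis s 1)) \<longleftrightarrow> i = h \<and> k = h" "?P i k (bwd_class (axis s 1)) \<longleftrightarrow> i = h \<and> k = h" for s
          using hub[OF i] hub[OF k] unfolding axis_class_data by auto
        show ?thesis
        proof (cases "i = h \<and> k = h")
          case True
          show ?thesis unfolding P if_P[OF True] e_axis ..
        next
          case False
          show ?thesis unfolding P if_not_P[OF False] by simp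
        qed
      qed
      \<comment> \<open>Each pendant vertex is the end of exactly one pendant direction, the hub of
        none.\<close>
      have one: "(\<Sum>j\<in>{1..<\<nu>}. if pend j = ?h l then 1 else 0 :: complex) = (if l = h then 0 else 1)"
        if l: "l < \<nu>" for l
      proof (cases "l = h")
        case True
        then show ?thesis using h(2) pend_nonzero by (intro trans[OF sum.neutral]) auto
      next
        case False
        from pd[OF l False] obtain j0 where j0: "1 \<le> j0" "j0 < \<nu>" "?h l = pend j0" by (elim exE conjE)
        have "(\<Sum>j\<in>{1..<\<nu>}. if pend j = ?h l then 1 else 0 :: complex) = (\<Sum>j\<in>{1..<\<nu>}. if j = j0 then 1 else 0)"
          using j0 by (intro sum.cong) (auto dest: pend_inj)
        then show ?thesis using j0 False by simp
      qed
      have "(\<Sum>j\<in>{1..<\<nu>}. (if ?P i k (fwd_class (pend j)) then ?e (fwd_class (pend j)) else 0)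
         + (if ?P i k (bwd_class (pend j)) then ?e (bwd_class (pend j)) else 0)) =
        (\<Sum>j\<in>{1..<\<nu>}. (if i = h then if pend j = ?h k then 1 else 0 else 0)
         + (if k = h then if pend j = ?h i then 1 else 0 else 0))"
      proof (intro sum.cong refl)
        fix j assume "j \<in> {1..<\<nu>}"
        then have j: "j < \<nu>" by simp
        have P: "?P i k (fwd_class (pend j)) \<longleftrightarrow> i = h \<and> pend j = ?h k"
          "?P i k (bwd_class (pend j)) \<longleftrightarrow> k = h \<and> pend j = ?h i"
          using hub[OF i] hub[OF k] unfolding pend_class_data[OF j] by auto
        have e: "?e (fwd_class (pend j)) = 1" "?e (bwd_class (pend j)) = 1"
          unfolding pend_class_data[OF j] by simp_all
        show "(if ?P i k (fwd_class (pend j)) then ?e (fwd_class (pend j)) else 0)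
           + (if ?P i k (bwd_class (pend j)) then ?e (bwd_class (pend j)) else 0) =
          (if i = h then if pend j = ?h k then 1 else 0 else 0)
           + (if k = h then if pend j = ?h i then 1 else 0 else 0)"
          unfolding P e by (cases "i = h"; cases "k = h") simp_all
      qed
      also have "\<dots> = (if i = h then if k = h then 0 else 1 else 0) + (if k = h then if i = h then 0 else 1 else 0)"
        using one[OF i] one[OF k] by (simp add: sum.distrib)
      finally show ?thesis unfolding sum_fund_oriented_edges[where P = "?P i k" and g = ?e] ax by simp
    qed
    have E: "complex_of_real (energy \<theta>) = 2 * of_nat CARD('d) - (\<Sum>s\<in>UNIV. of_real (2 * cos (vec_nth \<theta> s)))"
      by (simp add: energy_def sum_subtractf)
    show "floquet_matrix G \<theta> = arrow_mat \<nu> h (of_real (energy \<theta>) + of_nat (\<nu> - 1))"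
      unfolding floquet_matrix_def arrow_mat_def card_fund_verts_G
    proof (intro cong_mat refl)
      fix i k assume ik: "i < \<nu>" "k < \<nu>"
      show "(case (i, k) of (j, k) \<Rightarrow> (if j = k then of_nat (degree_at G (?h j)) else 0) -
          (\<Sum>c | c \<in> fund_oriented_edges G \<and> ?P j k c. ?e c)) =
        (case (i, k) of (i, k) \<Rightarrow> if i = h \<and> k = h then complex_of_real (energy \<theta>) + of_nat (\<nu> - 1)
          else if i = h \<or> k = h then - 1 else if i = k then 1 else 0)"
        unfolding prod.case S[OF ik] E using deg[OF ik(1)] by auto
    qed
  qed
qed

subsection \<open>The bands\<close>

definition disc :: "real \<Rightarrow> real" where
  "disc E = (E + real \<nu>)\<^sup>2 - 4 * E"

definition low :: "real \<Rightarrow> real" where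
  "low E = ((E + real \<nu>) - sqrt (disc E)) / 2"

definition high :: "real \<Rightarrow> real" where
  "high E = ((E + real \<nu>) + sqrt (disc E)) / 2"

lemma disc_nonneg: "0 \<le> disc E"
proof -
  \<comment> \<open>The square is completed in E; the remainder is positive since \<nu> \<ge> 2, so
    both roots are real for every real E.\<close>
  have "disc E = (E + real \<nu> - 2)\<^sup>2 + 4 * (real \<nu> - 1)"
    by (simp add: disc_def power2_eq_square algebra_simps)
  then show ?thesis using nu by simp
qed

lemma low_add_high: "low E + high E = E + real \<nu>"
  by (simp add: low_def high_def field_simps)

lemma low_mult_high: "low E * high E = E"
proof -
  have "low E * high E = ((E + real \<nu>)\<^sup>2 - (sqrt (disc E))\<^sup>2) / 4"
    unfolding low_def high_def power2_eq_square by (simp add: field_simps)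
  then show ?thesis using disc_nonneg[of E] by (simp add: disc_def)
qed

text \<open>The quadratic takes the negative value 1 - \<nu> at 1, so 1 lies strictly between its
  roots.\<close>

lemma low_less_1: "low E < 1" and high_greater_1: "1 < high E"
proof -
  have "(low E - 1) * (high E - 1) = low E * high E - (low E + high E) + 1"
    by (simp add: algebra_simps)
  also have "\<dots> = 1 - real \<nu>" by (simp add: low_mult_high low_add_high)
  also have "\<dots> < 0" using nu by simp
  finally have "(low E - 1) * (high E - 1) < 0" .
  moreover have "low E \<le> high E" using disc_nonneg[of E] by (simp add: low_def high_def)
  ultimately show "low E < 1" "1 < high E" by (auto simp: mult_less_0_iff)
qed

lemma quadratic_factorization:
  "(z - of_real (low E)) * (z - of_real (high E)) = z\<^sup>2 - of_real (E + real \<nu>) * z + (of_real E :: complex)"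
proof -
  have "(z - of_real (low E)) * (z - of_real (high E)) =
      z\<^sup>2 - of_real (low E + high E) * z + of_real (low E * high E)"
    by (simp add: power2_eq_square algebra_simps)
  then show ?thesis by (simp only: low_mult_high low_add_high)
qed

text \<open>The equation of the roots is linear in E with coefficient 1 - x, so a root other than 1
  determines E.\<close>

lemma energy_from_root:
  assumes "x = low E \<or> x = high E"
  shows "E * (1 - x) = x * (real \<nu> - x)"
proof -
  have "(x - low E) * (x - high E) = 0" using assms by auto
  then have "x\<^sup>2 - (low E + high E) * x + low E * high E = 0"
    by (simp add: power2_eq_square algebra_simps)
  then show ?thesis unfolding low_mult_high low_add_high by (simp add: power2_eq_square algebra_simps)
qed

lemma low_inj: "low E = low E' \<Longrightarrow> E = E'"
proof -
  assume e: "low E = low E'"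
  then have "E * (1 - low E) = E' * (1 - low E)"
    using energy_from_root[of "low E" E] energy_from_root[of "low E" E'] by simp
  then show ?thesis using low_less_1[of E] by (subst (asm) mult_cancel_right) simp
qed

lemma high_inj: "high E = high E' \<Longrightarrow> E = E'"
proof -
  assume e: "high E = high E'"
  then have "E * (1 - high E) = E' * (1 - high E)"
    using energy_from_root[of "high E" E] energy_from_root[of "high E" E'] by simp
  then show ?thesis using high_greater_1[of E] by (subst (asm) mult_cancel_right) simp
qed

definition energies :: "real set" where
  "energies = {0 .. 4 * real CARD('d)}"

lemma range_energy: "range energy = energies"
proof (intro equalityI subsetI)
  fix E assume "E \<in> range energy"
  then obtain \<theta> where E: "E = energy \<theta>" by auto
  have "0 \<le> energy \<theta>" unfolding energy_def by (intro sum_nonneg) auto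
  moreover have "energy \<theta> \<le> (\<Sum>s\<in>(UNIV :: 'd set). 4)"
    unfolding energy_def
  proof (rule sum_mono)
    fix s show "2 - 2 * cos (vec_nth \<theta> s) \<le> 4" using cos_ge_minus_one[of "vec_nth \<theta> s"] by linarith
  qed
  ultimately show "E \<in> energies" by (simp add: E energies_def)
next
  fix E assume E: "E \<in> energies"
  \<comment> \<open>With all coordinates equal to t the energy is 2 d (1 - cos t), which already
    reaches every value in [0, 4 d].\<close>
  define t where "t = arccos (1 - E / (2 * real CARD('d)))"
  have "cos t = 1 - E / (2 * real CARD('d))"
    unfolding t_def using E by (intro cos_arccos) (auto simp: energies_def field_simps)
  then have "energy (\<chi> s. t) = E" by (simp add: energy_def)
  then show "E \<in> range energy" by (metis rangeI)
qed

lemma sorted_eigenvalues_G: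
  "sorted_eigenvalues (floquet_matrix G \<theta>) =
    low (energy \<theta>) # replicate (\<nu> - 2) 1 @ [high (energy \<theta>)]"
proof (rule sorted_eigenvalues_eqI)
  let ?E = "energy \<theta>"
  show "sorted (low ?E # replicate (\<nu> - 2) 1 @ [high ?E])"
    using low_less_1[of ?E] high_greater_1[of ?E] by (auto simp: sorted_append)
  obtain h where h: "h < \<nu>" "floquet_matrix G \<theta> = arrow_mat \<nu> h (of_real ?E + of_nat (\<nu> - 1))"
    using floquet_matrix_G by metis
  have "char_poly (floquet_matrix G \<theta>) =
     [:- 1, 1:] ^ (\<nu> - 2) * ([:- of_real (low ?E), 1:] * [:- of_real (high ?E), 1:])"
    unfolding h(2)
  proof (rule char_poly_arrow_mat[OF h(1) nu])
    fix x :: complex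
    show "(x - 1) * (x - (of_real ?E + of_nat (\<nu> - 1))) - of_nat (\<nu> - 1) =
      (x - of_real (low ?E)) * (x - of_real (high ?E))"
      unfolding quadratic_factorization using nu by (simp add: power2_eq_square algebra_simps)
  qed
  then show "char_poly (floquet_matrix G \<theta>) =
      (\<Prod>x\<leftarrow>low ?E # replicate (\<nu> - 2) 1 @ [high ?E]. [:- complex_of_real x, 1:])"
    by (simp add: map_replicate prod_list_replicate mult_ac del: mult_pCons_left mult_pCons_right)
qed

lemma band_1: "band G 1 = low ` energies"
  unfolding band_def sorted_eigenvalues_G range_energy[symmetric] by (simp add: image_image)

lemma band_top: "band G \<nu> = high ` energies"
proof -
  have "(low E # replicate (\<nu> - 2) 1 @ [high E]) ! (\<nu> - 1) = high E" for E
  proof -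
    have "\<nu> - 1 = length (low E # replicate (\<nu> - 2) 1)" using nu by simp
    then show ?thesis by (metis append_Cons nth_append_length)
  qed
  then show ?thesis
    unfolding band_def sorted_eigenvalues_G range_energy[symmetric] by (simp only: image_image)
qed

lemma band_middle:
  assumes "2 \<le> n" "n \<le> \<nu> - 1"
  shows "band G n = {1}"
proof -
  have "(low E # replicate (\<nu> - 2) 1 @ [high E]) ! (n - 1) = 1" for E
    using assms by (simp add: nth_Cons' nth_append)
  then show ?thesis unfolding band_def sorted_eigenvalues_G by auto
qed

section \<open>The spectrum as the union of the bands\<close>

lemma UN_band: "(\<Union>n\<in>{1..\<nu>}. band G n) = low ` energies \<union> high ` energies \<union> {x. x = 1 \<and> 3 \<le> \<nu>}"
proof -
  have "{1..\<nu>} = insert 1 (insert \<nu> {2..\<nu> - 1})" using nu by auto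
  moreover have "(\<Union>n\<in>{2..\<nu> - 1}. band G n) = {x. x = 1 \<and> 3 \<le> \<nu>}"
    using band_middle by auto
  ultimately show ?thesis by (simp only: UN_insert band_1 band_top Un_assoc)
qed

text \<open>Clearing the denominator \<open>1 - z\<close> in the reduced equation produces the
  quadratic of the Floquet eigenvalues; here operator and bands meet.\<close>

lemma schur_iff:
  assumes "z \<noteq> 1"
  shows "schur z = of_real (2 * real CARD('d) - E) \<longleftrightarrow> z = of_real (low E) \<or> z = of_real (high E)"
proof -
  have "schur z = of_real (2 * real CARD('d) - E) \<longleftrightarrow>
      (schur z - of_real (2 * real CARD('d) - E)) * (1 - z) = 0"
    using assms by simp
  also have "schur z - of_real (2 * real CARD('d) - E) = of_real E + of_nat (\<nu> - 1) - z - of_nat (\<nu> - 1) / (1 - z)"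
    by (simp add: schur_def)
  also have "\<dots> * (1 - z) = (of_real E + of_nat (\<nu> - 1) - z) * (1 - z) - of_nat (\<nu> - 1)"
    using assms by (simp add: left_diff_distrib)
  also have "\<dots> = z\<^sup>2 - of_real (E + real \<nu>) * z + of_real E"
    using nu by (simp add: power2_eq_square algebra_simps)
  also have "\<dots> = (z - of_real (low E)) * (z - of_real (high E))"
    by (rule quadratic_factorization[symmetric])
  finally show ?thesis by simp
qed

lemma spectrum_G: "laplacian_spectrum G = complex_of_real ` (\<Union>n\<in>{1..\<nu>}. band G n)"
proof -
  have "z \<in> laplacian_spectrum G \<longleftrightarrow> z \<in> complex_of_real ` (\<Union>n\<in>{1..\<nu>}. band G n)" for z
  proof (cases "z = 1")
    case True
    \<comment> \<open>At the pole of \<open>schur\<close> both sides are compared directly: 1 is a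
      spectral point exactly when some index lies strictly between 1 and \<nu>.\<close>
    have "1 \<in> laplacian_spectrum G \<longleftrightarrow> 3 \<le> \<nu>"
      using one_in_spectrum one_not_in_spectrum nu by (cases "\<nu> = 2") auto
    moreover have "1 \<notin> low ` energies" "1 \<notin> high ` energies"
      using low_less_1 high_greater_1 by (metis imageE less_irrefl)+
    moreover have "1 \<in> complex_of_real ` S \<longleftrightarrow> 1 \<in> S" for S
      by (auto intro: image_eqI[of _ _ 1])
    ultimately show ?thesis unfolding UN_band True by simp
  next
    case False
    have "z \<in> laplacian_spectrum G \<longleftrightarrow>
        schur z \<in> complex_of_real ` {- 2 * real CARD('d) .. 2 * real CARD('d)}"
      using in_spectrum_schur[OF False] not_in_spectrum_schur[OF False] by blast
    also have "{- 2 * real CARD('d) .. 2 * real CARD('d)} = (\<lambda>E. 2 * real CARD('d) - E) ` energies"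
    proof -
      have "\<mu> \<in> (\<lambda>E. 2 * real CARD('d) - E) ` energies" if "\<mu> \<in> {- 2 * real CARD('d) .. 2 * real CARD('d)}" for \<mu>
        using that by (intro image_eqI[of _ _ "2 * real CARD('d) - \<mu>"]) (auto simp: energies_def)
      then show ?thesis by (auto simp: energies_def)
    qed
    also have "schur z \<in> complex_of_real ` \<dots> \<longleftrightarrow>
        (\<exists>E\<in>energies. schur z = of_real (2 * real CARD('d) - E))"
      by blast
    also have "\<dots> \<longleftrightarrow> (\<exists>E\<in>energies. z = of_real (low E) \<or> z = of_real (high E))"
      by (simp only: schur_iff[OF False])
    also have "\<dots> \<longleftrightarrow> z \<in> complex_of_real ` (\<Union>n\<in>{1..\<nu>}. band G n)"
      unfolding UN_band using False by auto
    finally show ?thesis .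
  qed
  then show ?thesis by blast
qed

lemma not_singleton_image_energies:
  assumes "\<And>E E'. f E = f E' \<Longrightarrow> E = E'"
  shows "\<not> is_singleton (f ` energies)"
proof
  assume "is_singleton (f ` energies)"
  then obtain x where x: "f ` energies = {x}" by (auto simp: is_singleton_def)
  have "0 \<in> energies" "4 * real CARD('d) \<in> energies" by (auto simp: energies_def)
  then have "f 0 \<in> {x}" "f (4 * real CARD('d)) \<in> {x}" unfolding x[symmetric] by blast+
  then have "f 0 = f (4 * real CARD('d))" by simp
  then show False using assms[of 0 "4 * real CARD('d)"] by simp
qed

lemma nondegenerate_bands: "{n \<in> {1..\<nu>}. \<not> is_singleton (band G n)} = {1, \<nu>}"
proof -
  have "\<not> is_singleton (band G 1)" "\<not> is_singleton (band G \<nu>)"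
    unfolding band_1 band_top by (rule not_singleton_image_energies, erule low_inj high_inj)+
  moreover have "is_singleton (band G n)" if "2 \<le> n" "n \<le> \<nu> - 1" for n
    using band_middle[OF that] by simp
  moreover have "{1..\<nu>} = insert 1 (insert \<nu> {2..\<nu> - 1})" using nu by auto
  ultimately show ?thesis by auto
qed

end

theorem proposition2p5:
  fixes \<nu> :: nat
  assumes "\<nu> \<ge> 2" and "CARD('d::finite) \<ge> 2"
  shows "\<exists>G :: 'd pgraph.
    periodic_graph G \<and> card (fund_verts G) = \<nu> \<and>
    laplacian_spectrum G = complex_of_real ` (\<Union>n\<in>{1..\<nu>}. band G n) \<and>
    {n \<in> {1..\<nu>}. \<not> is_singleton (band G n)} = {1, \<nu>} \<and>
    band G 1 \<inter> band G \<nu> = {} \<and>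
    (\<exists>c. (\<forall>n\<in>{2..\<nu> - 1}. band G n = {c}) \<and>
         (\<forall>x\<in>band G 1. x < c) \<and> (\<forall>y\<in>band G \<nu>. c < y))"
proof -
  obtain a b :: 'd where "a \<noteq> b"
    using assms(2) card_2_iff' by (metis (full_types) One_nat_def UNIV_I card_1_singleton_iff card_le_Suc0_iff_eq
      finite not_less_eq_eq numeral_2_eq_2)
  then interpret pendant_lattice a b \<nu> by unfold_locales (use assms in auto)
  have below: "\<forall>x\<in>band G 1. x < 1" and above: "\<forall>y\<in>band G \<nu>. 1 < y"
    unfolding band_1 band_top using low_less_1 high_greater_1 by auto
  show ?thesis
  proof (intro exI[of _ G] conjI)
    show "band G 1 \<inter> band G \<nu> = {}" using below above by fastforce
    \<comment> \<open>The witness 1 also serves \<nu> = 2, where no middle band exists and 1 is just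
      a point of the gap.\<close>
    show "\<exists>c. (\<forall>n\<in>{2..\<nu> - 1}. band G n = {c}) \<and>
         (\<forall>x\<in>band G 1. x < c) \<and> (\<forall>y\<in>band G \<nu>. c < y)"
      using below above band_middle by (intro exI[of _ 1]) auto
  qed (fact periodic_G card_fund_verts_G spectrum_G nondegenerate_bands)+
qed

end
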